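(* Let $W$ be a simply laced Weyl group of finite type, and let $X$ be a $W$-orbit of (unordered) pairs of orthogonal positive roots. (i) If $\rho_1=\{\alpha,\beta\}\in X$ and $\rho_1<_m\rho_2$ is a covering pair in $X$, then $\rho_2=\{s_i(\alpha),s_i(\beta)\}$ for some simple reflection $s_i$. Furthermore, if $x=B(\alpha_i,\alpha)$ and $y=B(\alpha_i,\beta)$, then $x,y\in\{-1,0,1\}$, and we do not have $x=y=0$. (ii) The partial order $\le_2$ refines the monoidal order $\le_m$; in other words, if $\rho_1,\rho_2\in X$ satisfy $\rho_1\le_m\rho_2$, then $\rho_1\le_2\rho_2$.
   Context: $W$ is the Weyl group of a Dynkin diagram $\Gamma$ of type $A_n$, $D_n$ ($n\ge4$), $E_6$, $E_7$ or $E_8$, with simple roots $\Pi=\{\alpha_1,\dots,\alpha_n\}$, a basis of the real reflection representation $V$, and $W$-invariant form $B$ with $B(\alpha_i,\alpha_i)=2$, $B(\alpha_i,\alpha_j)=-1$ for adjacent $i,j$, and $0$ otherwise; the simple reflection $s_i$ acts by $s_i(v)=v-B(\alpha_i,v)\alpha_i$. $\Phi_+$ is the set of positive roots; $\alpha,\beta$ are orthogonal if $B(\alpha,\beta)=0$. The height $\mathrm{ht}(\alpha)$ of a root is the sum of its coefficients in the basis $\Pi$. Put $\alpha\vee\beta=\alpha\otimes\beta+\beta\otimes\alpha$. Action on pairs. $W$ acts on unordered pairs $\rho=\{\alpha,\beta\}$ of orthogonal positive roots by $w(\rho)=\Phi_+\cap\{\pm w(\alpha),\pm w(\beta)\}$.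 Order $\le'$. For pairs $\rho_1,\rho_2$ in the same $W$-orbit, $\rho_1<'\rho_2$ if there exist $\gamma_1\in\rho_1\setminus\rho_2$ and $\gamma_2\in\rho_2\setminus\rho_1$, of minimal height in $\rho_1\setminus\rho_2$ and $\rho_2\setminus\rho_1$ respectively, with $\mathrm{ht}(\gamma_1)<\mathrm{ht}(\gamma_2)$. This is known to be a partial order on each orbit. Monoidal order $\le_m$. The partial order on $X$ whose covering relations are $\rho<_m s_i(\rho)$, where $s_i$ is a Coxeter generator with $s_i(\rho)\in X\setminus\{\rho\}$ and $\rho<' s_i(\rho)$ (i.e. the reflexive transitive closure of these relations). Canonical basis $\mathcal{B}$. The highest root of type $D_m$ ($m\ge4$) is the sum of the simple roots with coefficient $1$ at the endpoints of the diagram and $2$ at all other vertices. A positive root $\beta$ is elementary with respect to a simple root $\alpha_i$ if: (1) $\beta=\alpha_j$ is simple with $j\neq i$ not adjacent to $i$; or (2) $\beta=\alpha_h+\alpha_i+\alpha_j$ for a path $h$--$i$--$j$ in $\Gamma$; or (3) $\Gamma$ has a branch vertex, $i$ is not that vertex, and $\beta=\theta_i$ is the highest root of the standard parabolic subsystem of type $D_m$ ($m\ge4$) whose simple roots are those on the path from $i$ to the branch vertex together with all neighbours of the branch vertex. $\mathcal{B}$ is the set of all $\alpha_i\vee\beta$ with $\alpha_i\in\Pi$ and $\beta$ elementary with respect to $\alpha_i$ (in type $A_n$ only (1) and (2) occur). It is linearly independent and every 2-root $\alpha\vee\beta$ ($\alpha,\beta$ orthogonal roots) lies in $\mathbb{Z}\mathcal{B}$.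 Order $\le_2$. For $q_1,q_2\in\mathbb{Z}\mathcal{B}$, $q_1\le_2q_2$ if $q_2-q_1$ is a linear combination of elements of $\mathcal{B}$ with nonnegative coefficients. For pairs of orthogonal positive roots, $\{\alpha_1,\beta_1\}\le_2\{\alpha_2,\beta_2\}$ means $\alpha_1\vee\beta_1\le_2\alpha_2\vee\beta_2$. *)

theory Defs
  imports "HOL-Analysis.Finite_Cartesian_Product"
begin

section \<open>Diagrams of type A, D, E\<close>

text \<open>
  A diagram is its adjacency relation \<open>E\<close> on a finite type \<open>'n\<close> of vertices. The standard diagrams
  below carry the Bourbaki labelling on \<open>{1..n}\<close>.
\<close>

definition edge_A :: "nat \<Rightarrow> nat \<Rightarrow> nat \<Rightarrow> bool" where
  "edge_A n i j \<longleftrightarrow> {i, j} \<in> {{k, k + 1} | k. 1 \<le> k \<and> k < n}"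

definition edge_D :: "nat \<Rightarrow> nat \<Rightarrow> nat \<Rightarrow> bool" where
  "edge_D n i j \<longleftrightarrow> {i, j} \<in> {{k, k + 1} | k. 1 \<le> k \<and> k + 1 < n} \<union> {{n - 2, n}}"

definition edge_E :: "nat \<Rightarrow> nat \<Rightarrow> nat \<Rightarrow> bool" where
  "edge_E n i j \<longleftrightarrow> {i, j} \<in> {{k, k + 1} | k. 3 \<le> k \<and> k < n} \<union> {{1, 3}, {2, 4}}"

definition diagram_iso :: "('n::finite \<Rightarrow> 'n \<Rightarrow> bool) \<Rightarrow> (nat \<Rightarrow> nat \<Rightarrow> bool) \<Rightarrow> bool" where
  "diagram_iso E D \<longleftrightarrow>
     (\<exists>f. bij_betw f (UNIV :: 'n set) {1..CARD('n)} \<and> (\<forall>i j. E i j \<longleftrightarrow> D (f i) (f j)))"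

definition ade_diagram :: "('n::finite \<Rightarrow> 'n \<Rightarrow> bool) \<Rightarrow> bool" where
  "ade_diagram E \<longleftrightarrow>
     diagram_iso E (edge_A CARD('n)) \<or>
     (CARD('n) \<ge> 4 \<and> diagram_iso E (edge_D CARD('n))) \<or>
     (CARD('n) \<in> {6, 7, 8} \<and> diagram_iso E (edge_E CARD('n)))"


section \<open>Reflection representation and roots\<close>

text \<open>The space \<open>V\<close> is \<open>real ^ 'n\<close>; vectors are given by their coordinates in the simple roots.\<close>

definition simple_root :: "'n::finite \<Rightarrow> real ^ 'n" where
  "simple_root i = axis i 1"

definition cartan :: "('n::finite \<Rightarrow> 'n \<Rightarrow> bool) \<Rightarrow> 'n \<Rightarrow> 'n \<Rightarrow> real" where
  "cartan E i j = (if i = j then 2 else if E i j then -1 else 0)"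

definition bform :: "('n::finite \<Rightarrow> 'n \<Rightarrow> bool) \<Rightarrow> real ^ 'n \<Rightarrow> real ^ 'n \<Rightarrow> real" where
  "bform E u v = (\<Sum>i\<in>UNIV. \<Sum>j\<in>UNIV. u $ i * v $ j * cartan E i j)"

definition simple_refl :: "('n::finite \<Rightarrow> 'n \<Rightarrow> bool) \<Rightarrow> 'n \<Rightarrow> real ^ 'n \<Rightarrow> real ^ 'n" where
  "simple_refl E i v = v - bform E (simple_root i) v *\<^sub>R simple_root i"

text \<open>No closure under inverses is needed, since the simple reflections are involutions.\<close>

inductive_set weyl_group :: "('n::finite \<Rightarrow> 'n \<Rightarrow> bool) \<Rightarrow> (real ^ 'n \<Rightarrow> real ^ 'n) set"
  for E where
  one: "id \<in> weyl_group E"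
| step: "w \<in> weyl_group E \<Longrightarrow> simple_refl E i \<circ> w \<in> weyl_group E"

definition roots :: "('n::finite \<Rightarrow> 'n \<Rightarrow> bool) \<Rightarrow> (real ^ 'n) set" where
  "roots E = {w (simple_root i) | w i. w \<in> weyl_group E}"

definition pos_roots :: "('n::finite \<Rightarrow> 'n \<Rightarrow> bool) \<Rightarrow> (real ^ 'n) set" where
  "pos_roots E = {\<alpha> \<in> roots E. \<forall>i. 0 \<le> \<alpha> $ i}"

definition height :: "real ^ 'n::finite \<Rightarrow> real" where
  "height v = (\<Sum>i\<in>UNIV. v $ i)"


section \<open>Pairs of orthogonal positive roots\<close>

definition orth_pairs :: "('n::finite \<Rightarrow> 'n \<Rightarrow> bool) \<Rightarrow> (real ^ 'n) set set" where
  "orth_pairs E = {{\<alpha>, \<beta>} | \<alpha> \<beta>. \<alpha> \<in> pos_roots E \<and> \<beta> \<in> pos_roots E \<and> bform E \<alpha> \<beta> = 0}"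

definition pair_act ::
    "('n::finite \<Rightarrow> 'n \<Rightarrow> bool) \<Rightarrow> (real ^ 'n \<Rightarrow> real ^ 'n) \<Rightarrow> (real ^ 'n) set \<Rightarrow> (real ^ 'n) set" where
  "pair_act E w \<rho> = pos_roots E \<inter> (w ` \<rho> \<union> (\<lambda>v. - w v) ` \<rho>)"

definition pair_orbit :: "('n::finite \<Rightarrow> 'n \<Rightarrow> bool) \<Rightarrow> (real ^ 'n) set set \<Rightarrow> bool" where
  "pair_orbit E X \<longleftrightarrow> (\<exists>\<rho>\<in>orth_pairs E. X = {pair_act E w \<rho> | w. w \<in> weyl_group E})"

text \<open>The order \<open><'\<close>, used only for pairs in a common orbit.\<close>

definition pair_less :: "(real ^ 'n::finite) set \<Rightarrow> (real ^ 'n) set \<Rightarrow> bool" where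
  "pair_less \<rho>1 \<rho>2 \<longleftrightarrow>
     (\<exists>\<gamma>1 \<gamma>2. is_arg_min height (\<lambda>\<gamma>. \<gamma> \<in> \<rho>1 - \<rho>2) \<gamma>1 \<and>
              is_arg_min height (\<lambda>\<gamma>. \<gamma> \<in> \<rho>2 - \<rho>1) \<gamma>2 \<and>
              height \<gamma>1 < height \<gamma>2)"

text \<open>
  These are the relations \<open>\<rho> <\<^sub>m s\<^sub>i(\<rho>)\<close> that define the monoidal order as their reflexive transitive
  closure. Every cover of the resulting order on \<open>X\<close> is one of them.
\<close>

definition monoidal_cover ::
    "('n::finite \<Rightarrow> 'n \<Rightarrow> bool) \<Rightarrow> (real ^ 'n) set set \<Rightarrow> (real ^ 'n) set \<Rightarrow> (real ^ 'n) set \<Rightarrow> bool" where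
  "monoidal_cover E X \<rho>1 \<rho>2 \<longleftrightarrow>
     \<rho>1 \<in> X \<and> (\<exists>i. \<rho>2 = pair_act E (simple_refl E i) \<rho>1) \<and> \<rho>2 \<in> X - {\<rho>1} \<and> pair_less \<rho>1 \<rho>2"

definition monoidal_le ::
    "('n::finite \<Rightarrow> 'n \<Rightarrow> bool) \<Rightarrow> (real ^ 'n) set set \<Rightarrow> (real ^ 'n) set \<Rightarrow> (real ^ 'n) set \<Rightarrow> bool" where
  "monoidal_le E X \<rho>1 \<rho>2 \<longleftrightarrow> \<rho>1 \<in> X \<and> \<rho>2 \<in> X \<and> (monoidal_cover E X)\<^sup>*\<^sup>* \<rho>1 \<rho>2"


section \<open>The canonical basis and the order it defines\<close>

text \<open>The tensor square of \<open>V\<close> is \<open>real ^ 'n ^ 'n\<close>, with \<open>u \<otimes> v\<close> the matrix \<open>(u\<^sub>i v\<^sub>j)\<close>.\<close>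

definition tensor :: "real ^ 'n::finite \<Rightarrow> real ^ 'n \<Rightarrow> real ^ 'n ^ 'n" where
  "tensor u v = (\<chi> i j. u $ i * v $ j)"

definition vee :: "real ^ 'n::finite \<Rightarrow> real ^ 'n \<Rightarrow> real ^ 'n ^ 'n" where
  "vee u v = tensor u v + tensor v u"

definition branch_vertex :: "('n::finite \<Rightarrow> 'n \<Rightarrow> bool) \<Rightarrow> 'n \<Rightarrow> bool" where
  "branch_vertex E b \<longleftrightarrow> card {j. E b j} \<ge> 3"

definition path_between :: "('n::finite \<Rightarrow> 'n \<Rightarrow> bool) \<Rightarrow> 'n \<Rightarrow> 'n list \<Rightarrow> 'n \<Rightarrow> bool" where
  "path_between E i p j \<longleftrightarrow>
     p \<noteq> [] \<and> hd p = i \<and> last p = j \<and> distinct p \<and> successively E p"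

text \<open>
  If the subdiagram on \<open>S\<close> has type \<open>D\<^sub>m\<close> with \<open>m \<ge> 4\<close>, this is its highest root: coefficient 1 at the
  endpoints and 2 at the other vertices.
\<close>

definition highest_root_D :: "('n::finite \<Rightarrow> 'n \<Rightarrow> bool) \<Rightarrow> 'n set \<Rightarrow> real ^ 'n" where
  "highest_root_D E S =
     (\<Sum>k\<in>S. (if card {j \<in> S. E k j} = 1 then 1 else 2) *\<^sub>R simple_root k)"

text \<open>In \<open>branch\<close> the diagram is a tree, so \<open>p\<close> is unique.\<close>

inductive elementary :: "('n::finite \<Rightarrow> 'n \<Rightarrow> bool) \<Rightarrow> 'n \<Rightarrow> real ^ 'n \<Rightarrow> bool"
  for E i where
  simple: "j \<noteq> i \<Longrightarrow> \<not> E i j \<Longrightarrow> elementary E i (simple_root j)"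
| path: "h \<noteq> j \<Longrightarrow> E h i \<Longrightarrow> E i j \<Longrightarrow>
    elementary E i (simple_root h + simple_root i + simple_root j)"
| branch: "branch_vertex E b \<Longrightarrow> i \<noteq> b \<Longrightarrow> path_between E i p b \<Longrightarrow>
    elementary E i (highest_root_D E (set p \<union> {j. E b j}))"

definition canonical_basis :: "('n::finite \<Rightarrow> 'n \<Rightarrow> bool) \<Rightarrow> (real ^ 'n ^ 'n) set" where
  "canonical_basis E = {vee (simple_root i) \<beta> | i \<beta>. elementary E i \<beta>}"

definition basis_lattice :: "('n::finite \<Rightarrow> 'n \<Rightarrow> bool) \<Rightarrow> (real ^ 'n ^ 'n) set" where
  "basis_lattice E = {\<Sum>b\<in>canonical_basis E. real_of_int (c b) *\<^sub>R b | c. True}"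

definition le2 :: "('n::finite \<Rightarrow> 'n \<Rightarrow> bool) \<Rightarrow> real ^ 'n ^ 'n \<Rightarrow> real ^ 'n ^ 'n \<Rightarrow> bool" where
  "le2 E q1 q2 \<longleftrightarrow>
     q1 \<in> basis_lattice E \<and> q2 \<in> basis_lattice E \<and>
     (\<exists>c :: real ^ 'n ^ 'n \<Rightarrow> real. (\<forall>b\<in>canonical_basis E. 0 \<le> c b) \<and>
        q2 - q1 = (\<Sum>b\<in>canonical_basis E. c b *\<^sub>R b))"

definition pair_le2 ::
    "('n::finite \<Rightarrow> 'n \<Rightarrow> bool) \<Rightarrow> (real ^ 'n) set \<Rightarrow> (real ^ 'n) set \<Rightarrow> bool" where
  "pair_le2 E \<rho>1 \<rho>2 \<longleftrightarrow>
     \<rho>1 \<in> orth_pairs E \<and> \<rho>2 \<in> orth_pairs E \<and>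
     (\<exists>\<alpha>1 \<beta>1 \<alpha>2 \<beta>2. \<rho>1 = {\<alpha>1, \<beta>1} \<and> \<rho>2 = {\<alpha>2, \<beta>2} \<and> le2 E (vee \<alpha>1 \<beta>1) (vee \<alpha>2 \<beta>2))"

end

theory Submission
  imports Defs
begin

text \<open>
  Let \<open>x = B(\<alpha>\<^sub>i, \<alpha>)\<close> and \<open>y = B(\<alpha>\<^sub>i, \<beta>)\<close>. Expanding the symmetric product gives
  \<open>s\<^sub>i(\<alpha>) \<or> s\<^sub>i(\<beta>) - \<alpha> \<or> \<beta> = \<alpha>\<^sub>i \<or> \<gamma>\<close> with \<open>\<gamma> = x y \<alpha>\<^sub>i - y \<alpha> - x \<beta>\<close>. For a pair that is moved by
  \<open>s\<^sub>i\<close>, neither root is \<open>\<plusminus>\<alpha>\<^sub>i\<close>, so \<open>x\<close> and \<open>y\<close> are in \<open>{-1, 0, 1}\<close> and do not both vanish. A computation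
  then shows that \<open>\<gamma>\<close> has norm 2 and is orthogonal to \<open>\<alpha>\<^sub>i\<close>. Its coefficients
  therefore have the same sign, and the comparison of heights in the definition of a cover forces them to
  be nonnegative
  (\<open>cover_difference\<close>).

  It remains to see that \<open>\<alpha>\<^sub>i \<or> \<gamma>\<close> is a nonnegative integral combination of the canonical basis, which
  means that \<open>\<gamma>\<close> is such a combination of elementary roots (\<open>orthogonal_in_elementary_cone\<close>). Since the
  simple roots far from \<open>i\<close> are elementary, it is enough to subtract multiples of path roots
  \<open>\<alpha>\<^sub>h + \<alpha>\<^sub>i + \<alpha>\<^sub>j\<close> and of \<open>\<theta>\<^sub>i\<close> that clear the coefficients at \<open>i\<close> and its neighbours and leave all others
  nonnegative. Orthogonality dictates the multiples. The required inequalities between the coefficients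
  of \<open>\<gamma>\<close> all come from one principle: distinct integral vectors of norm at most 2 have product at
  most 1 (\<open>bform_le_1\<close>). It is applied to \<open>\<gamma>\<close> and the sum of the simple roots along a path, where the
  product telescopes as long as the path avoids the branch vertex (\<open>flux\<close>).

  The diagrams enter only through positive definiteness, the bound 3 on the number of neighbours, and the
  uniqueness of the branch vertex; in particular, positive definiteness excludes cycles (\<open>no_cycle\<close>).
  The order \<open>\<le>\<^sub>2\<close> also requires that all products \<open>\<alpha> \<or> \<beta>\<close> lie in the lattice spanned by the canonical
  basis. The identity above, applied to a reflection that lowers the height of \<open>\<alpha>\<close>, reduces this to the
  case of a simple \<open>\<alpha>\<close>, where it is the same decomposition of \<open>\<beta>\<close> or \<open>-\<beta>\<close> (\<open>two_root_in_lattice\<close>).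
\<close>

section \<open>Positive definiteness for the diagrams A, D and E\<close>

lemma edge_A_iff: "edge_A n i j \<longleftrightarrow> (1 \<le> i \<and> i < n \<and> j = i + 1) \<or> (1 \<le> j \<and> j < n \<and> i = j + 1)"
  unfolding edge_A_def by (auto simp: doubleton_eq_iff)

lemma edge_D_iff:
  "edge_D n i j \<longleftrightarrow> (1 \<le> i \<and> i + 1 < n \<and> j = i + 1) \<or> (1 \<le> j \<and> j + 1 < n \<and> i = j + 1) \<or>
     (i = n - 2 \<and> j = n) \<or> (i = n \<and> j = n - 2)"
  unfolding edge_D_def by (auto simp: doubleton_eq_iff)

lemma edge_E_iff:
  "edge_E n i j \<longleftrightarrow> (3 \<le> i \<and> i < n \<and> j = i + 1) \<or> (3 \<le> j \<and> j < n \<and> i = j + 1) \<or>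
     (i = 1 \<and> j = 3) \<or> (i = 3 \<and> j = 1) \<or> (i = 2 \<and> j = 4) \<or> (i = 4 \<and> j = 2)"
  unfolding edge_E_def by (auto simp: doubleton_eq_iff)

text \<open>
  The combinatorial data through which the classification enters: \<open>N k\<close> contains all neighbours of
\<open>k\<close>, the positive function \<open>w\<close> is strictly superharmonic (twice its value at a vertex exceeds the
sum over the neighbours), and \<open>b\<close> is the only vertex that may have three neighbours. The sets
\<open>N k\<close> may reach outside \<open>{1..n}\<close>, where \<open>w\<close> vanishes; this avoids treating endpoints separately.
\<close>

definition weighted_star :: "nat \<Rightarrow> (nat \<Rightarrow> nat \<Rightarrow> bool) \<Rightarrow> (nat \<Rightarrow> nat set) \<Rightarrow> (nat \<Rightarrow> real) \<Rightarrow> nat \<Rightarrow> bool"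
  where
  "weighted_star n D N w b \<longleftrightarrow>
     (\<forall>k\<in>{1..n}. 0 < w k \<and> \<not> D k k \<and> finite (N k) \<and> {m \<in> {1..n}. D k m} \<subseteq> N k \<and>
        (\<forall>m\<in>N k. 0 \<le> w m) \<and> sum w (N k) < 2 * w k \<and>
        card (N k) \<le> (if k = b then 3 else 2)) \<and>
     (\<forall>k m. D k m \<longrightarrow> D m k)"

text \<open>
  The weights are the coefficients of the sum of all positive roots. This sum pairs to 2 with every
simple root, so that superharmonicity holds with a constant defect. The weights in types D and E come
from the same sum, doubled in type D.
\<close>

lemma weighted_star_A:
  "weighted_star n (edge_A n) (\<lambda>k. {k - 1, k + 1}) (\<lambda>k. real k * (real n + 1 - real k)) 0"
  unfolding weighted_star_def
proof (intro conjI ballI allI impI)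
  fix k assume k: "k \<in> {1..n}"
  show "0 < real k * (real n + 1 - real k)" using k by auto
  show "\<not> edge_A n k k" by (simp add: edge_A_iff)
  show "finite {k - 1, k + 1}" by simp
  show "{m \<in> {1..n}. edge_A n k m} \<subseteq> {k - 1, k + 1}" by (auto simp: edge_A_iff)
  show "0 \<le> real m * (real n + 1 - real m)" if "m \<in> {k - 1, k + 1}" for m
    using that k by auto
  show "(\<Sum>k\<in>{k - 1, k + 1}. real k * (real n + 1 - real k)) < 2 * (real k * (real n + 1 - real k))"
    using k by (simp add: algebra_simps)
  show "card {k - 1, k + 1} \<le> (if k = 0 then 3 else 2)" using card_insert_le_m1[of 2 "{k+1}" "k-1"] by auto
qed (auto simp: edge_A_iff)

lemma weighted_star_D:
  assumes "4 \<le> n"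
  shows "weighted_star n (edge_D n)
    (\<lambda>k. if k = n - 2 then {n - 3, n - 1, n} else if n - 2 < k then {n - 2} else {k - 1, k + 1})
    (\<lambda>k. if n - 2 < k then real n * (real n - 1) else 2 * real k * (2 * real n - 1 - real k)) (n - 2)"
    (is "weighted_star n _ ?N ?w _")
  unfolding weighted_star_def
proof (intro conjI ballI allI impI)
  fix k assume k: "k \<in> {1..n}"
  show "0 < ?w k" using k assms by auto
  show "\<not> edge_D n k k" using assms by (auto simp: edge_D_iff)
  show "finite (?N k)" by simp
  show "{m \<in> {1..n}. edge_D n k m} \<subseteq> ?N k" using assms by (auto simp: edge_D_iff)
  show "0 \<le> ?w m" if "m \<in> ?N k" for m
    using that k assms by (auto split: if_splits)
  show "card (?N k) \<le> (if k = n - 2 then 3 else 2)"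
    using assms k by (auto simp: card_insert_if)
  consider "k = n - 2" | "k = n - 1" | "k = n" | "k < n - 2" using k by fastforce
  then show "sum ?w (?N k) < 2 * ?w k"
  proof cases
    case 1
    have "n - 3 \<noteq> n - 1" "n - 3 \<noteq> n" "n - 1 \<noteq> n" "n - 2 < n - 1" "\<not> n - 2 < n - 3"
      using assms by auto
    then show ?thesis using 1 assms by (simp add: algebra_simps)
  next
    case 4
    have "k - 1 \<noteq> k + 1" "\<not> n - 2 < k - 1" "\<not> n - 2 < k + 1" using 4 by auto
    then show ?thesis using 4 assms k by (simp add: algebra_simps)
  qed (use assms in \<open>auto simp: algebra_simps\<close>)
qed (use assms in \<open>auto simp: edge_D_iff\<close>)

text \<open>
  Entry \<open>k\<close> is the weight of vertex \<open>k\<close> in the Bourbaki numbering, padded by 0 at the positions 0 and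
\<open>n + 1\<close>.
\<close>

definition weight_E :: "nat \<Rightarrow> real list" where
  "weight_E n = (if n = 6 then [0, 16, 22, 30, 42, 30, 16, 0]
     else if n = 7 then [0, 34, 49, 66, 96, 75, 52, 27, 0]
     else [0, 92, 136, 182, 270, 220, 168, 114, 58, 0])"

lemma weighted_star_E:
  assumes "n \<in> {6, 7, 8}"
  shows "weighted_star n (edge_E n)
    (\<lambda>k. if k = 1 then {3} else if k = 2 then {4} else if k = 3 then {1, 4}
         else if k = 4 then {2, 3, 5} else {k - 1, k + 1})
    ((!) (weight_E n)) 4"
    (is "weighted_star n _ ?N ?w _")
  unfolding weighted_star_def
proof (intro conjI ballI allI impI)
  fix k assume k: "k \<in> {1..n}"
  show "\<not> edge_E n k k" using assms by (auto simp: edge_E_iff)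
  show "finite (?N k)" by simp
  show "{m \<in> {1..n}. edge_E n k m} \<subseteq> ?N k" using assms by (auto simp: edge_E_iff)
  show "card (?N k) \<le> (if k = 4 then 3 else 2)"
    by (auto simp: card_insert_if)
  have kc: "k = 1 \<or> k = 2 \<or> k = 3 \<or> k = 4 \<or> k = 5 \<or> k = 6 \<or> k = 7 \<and> n \<ge> 7 \<or> k = 8 \<and> n \<ge> 8"
    using k assms by auto
  show "0 < ?w k" using kc assms by (auto simp: weight_E_def)
  show "0 \<le> ?w m" if "m \<in> ?N k" for m
    using that kc assms by (auto simp: weight_E_def)
  show "sum ?w (?N k) < 2 * ?w k"
    using kc assms by (auto simp: weight_E_def)
qed (use assms in \<open>auto simp: edge_E_iff\<close>)

lemma weighted_star_transfer:
  fixes E :: "'n::finite \<Rightarrow> 'n \<Rightarrow> bool"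
  assumes "diagram_iso E D" "weighted_star CARD('n) D N w b"
  shows "\<exists>d. (\<forall>i. 0 < d i \<and> \<not> E i i \<and> (\<Sum>j | E i j. d j) < 2 * (d i :: real)) \<and>
    (\<forall>i j. E i j \<longrightarrow> E j i) \<and> (\<forall>i. card {j. E i j} \<le> 3) \<and>
    (\<forall>i j. branch_vertex E i \<longrightarrow> branch_vertex E j \<longrightarrow> i = j)"
proof -
  obtain f where f: "bij_betw f (UNIV :: 'n set) {1..CARD('n)}"
    and E: "\<And>i j. E i j \<longleftrightarrow> D (f i) (f j)"
    using assms(1) unfolding diagram_iso_def by blast
  have inj: "inj f" and rng: "\<And>i. f i \<in> {1..CARD('n)}"
    using f by (auto simp: bij_betw_def)
  note W = assms(2)[unfolded weighted_star_def, THEN conjunct1, rule_format, OF rng]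
  have sub: "f ` {j. E i j} \<subseteq> N (f i)" for i
    using W[of i] rng E by blast
  have card: "card {j. E i j} \<le> (if f i = b then 3 else 2)" for i
  proof -
    have "card {j. E i j} = card (f ` {j. E i j})"
      using inj by (simp add: card_image inj_on_subset)
    also have "\<dots> \<le> card (N (f i))" using sub W[of i] by (simp add: card_mono)
    finally show ?thesis using W[of i] by linarith
  qed
  have wsum: "(\<Sum>j | E i j. w (f j)) < 2 * w (f i)" for i
  proof -
    have "(\<Sum>j | E i j. w (f j)) = sum w (f ` {j. E i j})"
      using inj by (simp add: sum.reindex inj_on_subset)
    also have "\<dots> \<le> sum w (N (f i))"
      using sub W[of i] by (intro sum_mono2) auto
    finally show ?thesis using W[of i] by linarith
  qed
  have br: "f i = b" if "branch_vertex E i" for i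
    using that card[of i] by (auto simp: branch_vertex_def split: if_splits)
  have le3: "card {j. E i j} \<le> 3" for i using card[of i] by (auto split: if_splits)
  have sy: "E i j \<Longrightarrow> E j i" for i j
    using assms(2)[unfolded weighted_star_def, THEN conjunct2] E by blast
  show ?thesis
  proof (rule exI[of _ "\<lambda>i. w (f i)"], intro conjI allI impI)
    show "i = j" if "branch_vertex E i" "branch_vertex E j" for i j
      using br[OF that(1)] br[OF that(2)] injD[OF inj] by metis
  qed (use W wsum le3 sy E in auto)
qed

lemma ade_diagram_weights:
  fixes E :: "'n::finite \<Rightarrow> 'n \<Rightarrow> bool"
  assumes "ade_diagram E"
  shows "\<exists>d. (\<forall>i. 0 < d i \<and> \<not> E i i \<and> (\<Sum>j | E i j. d j) < 2 * (d i :: real)) \<and>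
    (\<forall>i j. E i j \<longrightarrow> E j i) \<and> (\<forall>i. card {j. E i j} \<le> 3) \<and>
    (\<forall>i j. branch_vertex E i \<longrightarrow> branch_vertex E j \<longrightarrow> i = j)"
  using assms weighted_star_A weighted_star_D weighted_star_E weighted_star_transfer
  unfolding ade_diagram_def by (metis (no_types, lifting))

lemma sum_over_Collect: "(\<Sum>j | P j. g j) = (\<Sum>j\<in>UNIV. if P j then g j else 0)"
  for g :: "'n::finite \<Rightarrow> 'a::comm_monoid_add"
  using sum.inter_filter[of UNIV g P] by simp

lemma bform_left: "bform E u v = (\<Sum>i\<in>UNIV. u $ i * (\<Sum>j\<in>UNIV. v $ j * cartan E i j))"
  unfolding bform_def by (simp add: sum_distrib_left mult.assoc)

text \<open>
  The weighted arithmetic-geometric inequality on an edge, with weights \<open>d j / d i\<close> and \<open>d i / d j\<close>,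
bounds the form below by a diagonal form with the entries \<open>2 - (\<Sum>j. d j) / d i\<close>, the sum being
over the neighbours of \<open>i\<close>. A strictly superharmonic \<open>d\<close> makes these entries positive.
\<close>

lemma posdef_of_weights:
  fixes E :: "'n::finite \<Rightarrow> 'n \<Rightarrow> bool" and d :: "'n \<Rightarrow> real"
  assumes sym: "\<And>i j. E i j \<Longrightarrow> E j i" and irr: "\<And>i. \<not> E i i"
    and d: "\<And>i. 0 < d i" and super: "\<And>i. (\<Sum>j | E i j. d j) < 2 * d i"
    and "v \<noteq> 0"
  shows "0 < bform E v v"
proof -
  let ?e = "\<lambda>i j. if E i j then 1 else 0 :: real"
  have Q: "bform E v v = (\<Sum>i\<in>UNIV. 2 * (v $ i)\<^sup>2) - (\<Sum>i\<in>UNIV. \<Sum>j\<in>UNIV. ?e i j * (v $ i * v $ j))"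
  proof -
    have "v $ i * v $ j * cartan E i j = (if j = i then 2 * (v $ i)\<^sup>2 else 0) - ?e i j * (v $ i * v $ j)" for i j
      using irr by (auto simp: cartan_def power2_eq_square)
    then show ?thesis unfolding bform_def
      by (simp add: sum_subtractf)
  qed
  have am_gm: "?e i j * (v $ i * v $ j) \<le>
      ?e i j * (d j / d i * (v $ i)\<^sup>2 / 2) + ?e j i * (d i / d j * (v $ j)\<^sup>2 / 2)" for i j
  proof (cases "E i j")
    case True
    have "0 \<le> (d j * v $ i - d i * v $ j)\<^sup>2 / (2 * d i * d j)" using d[of i] d[of j] by simp
    also have "\<dots> = d j / d i * (v $ i)\<^sup>2 / 2 + d i / d j * (v $ j)\<^sup>2 / 2 - v $ i * v $ j"
      using d[of i] d[of j] by (simp add: power2_eq_square field_simps)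
    finally show ?thesis using True sym[OF True] by simp
  qed (use sym in auto)
  have "(\<Sum>i\<in>UNIV. \<Sum>j\<in>UNIV. ?e i j * (v $ i * v $ j)) \<le>
      (\<Sum>i\<in>UNIV. \<Sum>j\<in>UNIV. ?e i j * (d j / d i * (v $ i)\<^sup>2 / 2)) +
      (\<Sum>i\<in>UNIV. \<Sum>j\<in>UNIV. ?e j i * (d i / d j * (v $ j)\<^sup>2 / 2))"
    unfolding sum.distrib[symmetric] by (intro sum_mono am_gm)
  also have "(\<Sum>i\<in>UNIV. \<Sum>j\<in>UNIV. ?e j i * (d i / d j * (v $ j)\<^sup>2 / 2)) =
      (\<Sum>i\<in>UNIV. \<Sum>j\<in>UNIV. ?e i j * (d j / d i * (v $ i)\<^sup>2 / 2))"
    by (rule sum.swap)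
  also have "(\<Sum>i\<in>UNIV. \<Sum>j\<in>UNIV. ?e i j * (d j / d i * (v $ i)\<^sup>2 / 2)) =
      (\<Sum>i\<in>UNIV. \<Sum>j\<in>UNIV. ?e i j * (d j / d i * (v $ i)\<^sup>2)) / 2"
    unfolding sum_divide_distrib by simp
  finally have "(\<Sum>i\<in>UNIV. \<Sum>j\<in>UNIV. ?e i j * (v $ i * v $ j)) \<le>
      (\<Sum>i\<in>UNIV. \<Sum>j\<in>UNIV. ?e i j * (d j / d i * (v $ i)\<^sup>2))"
    unfolding field_sum_of_halves .
  also have "\<dots> = (\<Sum>i\<in>UNIV. (v $ i)\<^sup>2 / d i * (\<Sum>j | E i j. d j))"
    unfolding sum_over_Collect sum_distrib_left by (intro sum.cong) auto
  also have "\<dots> < (\<Sum>i\<in>UNIV. 2 * (v $ i)\<^sup>2)"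
  proof (rule sum_strict_mono_ex1)
    have eq: "2 * (v $ i)\<^sup>2 = (v $ i)\<^sup>2 / d i * (2 * d i)" for i using d[of i] by simp
    show "\<forall>i\<in>UNIV. (v $ i)\<^sup>2 / d i * (\<Sum>j | E i j. d j) \<le> 2 * (v $ i)\<^sup>2"
      unfolding eq using d super by (intro ballI mult_left_mono) (auto intro: less_imp_le simp: divide_nonneg_pos)
    obtain i where "v $ i \<noteq> 0" using assms(5) by (auto simp: vec_eq_iff)
    then have "(v $ i)\<^sup>2 / d i * (\<Sum>j | E i j. d j) < 2 * (v $ i)\<^sup>2"
      unfolding eq using d[of i] super[of i] by (intro mult_strict_left_mono) auto
    then show "\<exists>i\<in>UNIV. (v $ i)\<^sup>2 / d i * (\<Sum>j | E i j. d j) < 2 * (v $ i)\<^sup>2" by blast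
  qed simp
  finally show ?thesis unfolding Q by simp
qed

section \<open>Integral vectors of norm 2\<close>

definition integral_vec :: "real ^ 'n \<Rightarrow> bool" where
  "integral_vec v \<longleftrightarrow> (\<forall>i. v $ i \<in> \<int>)"

lemma integral_vec_add: "integral_vec u \<Longrightarrow> integral_vec v \<Longrightarrow> integral_vec (u + v)"
  and integral_vec_diff: "integral_vec u \<Longrightarrow> integral_vec v \<Longrightarrow> integral_vec (u - v)"
  and integral_vec_uminus: "integral_vec u \<Longrightarrow> integral_vec (- u)"
  and integral_vec_scale: "a \<in> \<int> \<Longrightarrow> integral_vec u \<Longrightarrow> integral_vec (a *\<^sub>R u)"
  and integral_vec_simple: "integral_vec (simple_root i)"
  by (auto simp: integral_vec_def simple_root_def axis_def)

lemma integral_vec_sum: "(\<And>k. k \<in> S \<Longrightarrow> integral_vec (f k)) \<Longrightarrow> integral_vec (\<Sum>k\<in>S. f k)"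
  by (auto simp: integral_vec_def)

lemmas integral_vec_intros =
  integral_vec_add integral_vec_diff integral_vec_uminus integral_vec_scale integral_vec_simple
  integral_vec_sum

lemma bform_integral: "integral_vec u \<Longrightarrow> integral_vec v \<Longrightarrow> bform E u v \<in> \<int>"
  unfolding bform_def integral_vec_def by (intro Ints_sum Ints_mult) (auto simp: cartan_def)

lemma bform_add_left: "bform E (u + v) w = bform E u w + bform E v w"
  and bform_add_right: "bform E w (u + v) = bform E w u + bform E w v"
  and bform_diff_left: "bform E (u - v) w = bform E u w - bform E v w"
  and bform_diff_right: "bform E w (u - v) = bform E w u - bform E w v"
  and bform_scale_left: "bform E (a *\<^sub>R u) w = a * bform E u w"
  and bform_scale_right: "bform E w (a *\<^sub>R u) = a * bform E w u"
  by (simp_all add: bform_def algebra_simps sum.distrib sum_subtractf sum_distrib_left)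

lemma bform_zero_left: "bform E 0 w = 0"
  and bform_zero_right: "bform E w 0 = 0"
  and bform_minus_left: "bform E (- u) w = - bform E u w"
  and bform_minus_right: "bform E w (- u) = - bform E w u"
  using bform_scale_left[of E 0 0 w] bform_scale_right[of E w 0 0]
    bform_scale_left[of E "-1" u w] bform_scale_right[of E w "-1" u] by simp_all

lemmas bform_linear = bform_add_left bform_add_right bform_diff_left bform_diff_right
  bform_scale_left bform_scale_right bform_zero_left bform_zero_right
  bform_minus_left bform_minus_right

lemma bform_sum_left: "bform E (\<Sum>k\<in>S. f k) w = (\<Sum>k\<in>S. bform E (f k) w)"
  by (induction S rule: infinite_finite_induct) (simp_all add: bform_linear)

lemma simple_root_nth: "simple_root i $ k = (if k = i then 1 else 0)"
  by (auto simp: simple_root_def axis_def)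

lemma vec_eq_sum_simple_roots: "v = (\<Sum>k\<in>UNIV. v $ k *\<^sub>R simple_root k)"
  by (simp add: vec_eq_iff simple_root_nth if_distrib cong: if_cong)

lemma height_linear:
  "height (u + v) = height u + height v" "height (u - v) = height u - height v"
  "height (a *\<^sub>R u) = a * height u" "height (- u) = - height u" "height (simple_root i) = 1"
  by (simp_all add: height_def sum.distrib sum_subtractf sum_distrib_left sum_negf simple_root_nth)

lemma Ints_pos_ge_1: "(x::real) \<in> \<int> \<Longrightarrow> 0 < x \<Longrightarrow> 1 \<le> x"
  by (auto elim!: Ints_cases)

locale posdef_diagram =
  fixes E :: "'n::finite \<Rightarrow> 'n \<Rightarrow> bool"
  assumes edge_sym: "E i j \<Longrightarrow> E j i"
    and edge_irrefl: "\<not> E i i"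
    and posdef: "v \<noteq> 0 \<Longrightarrow> 0 < bform E v v"
begin

lemma cartan_sym: "cartan E i j = cartan E j i"
  using edge_sym by (auto simp: cartan_def)

lemma bform_sym: "bform E u v = bform E v u"
  unfolding bform_def by (subst sum.swap) (simp add: cartan_sym mult.commute mult.left_commute)

lemma bform_simple: "bform E (simple_root i) v = 2 * v $ i - (\<Sum>j | E i j. v $ j)"
proof -
  have "bform E (simple_root i) v = (\<Sum>j\<in>UNIV. v $ j * cartan E i j)"
    unfolding bform_left
    by (simp add: simple_root_nth if_distrib[of "\<lambda>x. x * _"] cong: if_cong)
  also have "\<dots> = (\<Sum>j\<in>UNIV. (if j = i then 2 * v $ i else 0) - (if E i j then v $ j else 0))"
    using edge_irrefl by (intro sum.cong) (auto simp: cartan_def)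
  also have "\<dots> = 2 * v $ i - (\<Sum>j | E i j. v $ j)"
    by (simp add: sum_subtractf sum_over_Collect)
  finally show ?thesis .
qed

lemma bform_simple_simple: "bform E (simple_root i) (simple_root j) = cartan E i j"
  unfolding bform_left
    by (simp add: simple_root_nth if_distrib[of "\<lambda>x. x * _"] cong: if_cong)

lemma bform_expand: "bform E u v = (\<Sum>i\<in>UNIV. u $ i * bform E (simple_root i) v)"
  by (subst vec_eq_sum_simple_roots[of u]) (simp add: bform_sum_left bform_linear)

text \<open>
  Every root is such a vector. Working with this description, that a given combination of roots belongs
to the class is a computation with the form, without a search for a Weyl group element.
\<close>

definition norm2 :: "real ^ 'n \<Rightarrow> bool" where
  "norm2 v \<longleftrightarrow> integral_vec v \<and> bform E v v = 2"

definition pos_norm2 :: "real ^ 'n \<Rightarrow> bool" where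
  "pos_norm2 v \<longleftrightarrow> norm2 v \<and> (\<forall>i. 0 \<le> v $ i)"

lemma norm2_simple: "norm2 (simple_root i)"
  by (simp add: norm2_def integral_vec_simple bform_simple_simple cartan_def)

lemma pos_norm2_simple: "pos_norm2 (simple_root i)"
  by (simp add: pos_norm2_def norm2_simple simple_root_nth)

lemma norm2_uminus: "norm2 v \<Longrightarrow> norm2 (- v)"
  by (simp add: norm2_def integral_vec_uminus bform_linear)

lemma norm2_nonzero: "norm2 v \<Longrightarrow> v \<noteq> 0"
  by (auto simp: norm2_def bform_linear)

text \<open>
  Adding a multiple \<open>a \<alpha>\<^sub>k\<close> to \<open>v\<close> changes the form by \<open>2 a\<^sup>2 + 2 a B(\<alpha>\<^sub>k, v)\<close>, an even integer.
\<close>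

lemma bform_even:
  assumes "integral_vec v"
  shows "bform E v v / 2 \<in> \<int>"
proof -
  have "bform E (\<Sum>k\<in>S. v $ k *\<^sub>R simple_root k) (\<Sum>k\<in>S. v $ k *\<^sub>R simple_root k) / 2 \<in> \<int>" for S
  proof (induction S rule: infinite_finite_induct)
    case (insert k S)
    let ?w = "\<Sum>k\<in>S. v $ k *\<^sub>R simple_root k :: real ^ 'n"
    have vk: "v $ k \<in> \<int>" using assms by (simp add: integral_vec_def)
    have w: "integral_vec ?w"
      using assms by (intro integral_vec_intros) (simp add: integral_vec_def)
    have "bform E (v $ k *\<^sub>R simple_root k + ?w) (v $ k *\<^sub>R simple_root k + ?w) / 2 =
      (v $ k)\<^sup>2 + v $ k * bform E (simple_root k) ?w + bform E ?w ?w / 2"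
      by (simp add: bform_linear bform_simple_simple cartan_def bform_sym[of ?w "simple_root k"]
          power2_eq_square field_simps)
    also have "\<dots> \<in> \<int>"
      using insert.IH vk bform_integral[OF integral_vec_simple w]
      by (intro Ints_add Ints_mult Ints_power) auto
    finally show ?case using insert by simp
  qed (simp_all add: bform_linear)
  from this[of UNIV] show ?thesis using vec_eq_sum_simple_roots[of v] by simp
qed

lemma bform_ge_2: "integral_vec v \<Longrightarrow> v \<noteq> 0 \<Longrightarrow> 2 \<le> bform E v v"
  using Ints_pos_ge_1[OF bform_even] posdef[of v] by force

text \<open>
  If \<open>v = p - q\<close> with \<open>p\<close>, \<open>q\<close> nonnegative, nonzero and of disjoint support, then \<open>B(p, q) \<le> 0\<close>,
so \<open>B(v, v) \<ge> B(p, p) + B(q, q) \<ge> 4\<close>, as the lattice is even.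
\<close>

lemma norm2_pos_or_neg:
  assumes "norm2 v"
  shows "pos_norm2 v \<or> pos_norm2 (- v)"
proof (rule ccontr)
  assume *: "\<not> ?thesis"
  define p :: "real ^ 'n" where "p = (\<chi> i. max (v $ i) 0)"
  define q :: "real ^ 'n" where "q = (\<chi> i. max (- v $ i) 0)"
  have v: "integral_vec v" "bform E v v = 2" using assms by (auto simp: norm2_def)
  have int: "integral_vec p" "integral_vec q"
    using v(1) by (auto simp: p_def q_def integral_vec_def max_def)
  have vpq: "v = p - q" by (simp add: vec_eq_iff p_def q_def max_def)
  obtain i j where "v $ i < 0" "0 < v $ j"
    using * assms norm2_uminus[OF assms] by (auto simp: pos_norm2_def not_le)
  then have "q $ i \<noteq> 0" "p $ j \<noteq> 0" by (auto simp: p_def q_def)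
  then have "q \<noteq> 0" "p \<noteq> 0" by auto
  then have "2 \<le> bform E p p" "2 \<le> bform E q q"
    using int bform_ge_2 by blast+
  moreover have "bform E p q \<le> 0"
    unfolding bform_def
  proof (intro sum_nonpos)
    fix k l
    show "p $ k * q $ l * cartan E k l \<le> 0"
      by (auto simp: p_def q_def cartan_def max_def mult_le_0_iff zero_le_mult_iff)
  qed
  ultimately show False
    using v(2) unfolding vpq by (simp add: bform_linear bform_sym[of q p])
qed

text \<open>
  Positivity of \<open>B(u - v, u - v) \<le> 4 - 2 B(u, v)\<close> together with integrality. Applied to a vector \<open>u\<close>
supported on a path, this is the source of the inequalities between coefficients of roots below.
\<close>

lemma bform_le_1:
  assumes "integral_vec u" "integral_vec v" "bform E u u \<le> 2" "bform E v v \<le> 2" "u \<noteq> v"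
  shows "bform E u v \<le> 1"
proof -
  have "0 < bform E (u - v) (u - v)" using assms by (intro posdef) auto
  also have "\<dots> \<le> 4 - 2 * bform E u v"
    using assms(3,4) by (simp add: bform_linear bform_sym[of v u])
  finally have "0 < 2 - bform E u v" by simp
  then have "1 \<le> 2 - bform E u v"
    using assms bform_integral by (intro Ints_pos_ge_1) auto
  then show ?thesis by simp
qed

lemma height_pos: "pos_norm2 v \<Longrightarrow> 0 < height v"
proof -
  assume v: "pos_norm2 v"
  then obtain i where "v $ i \<noteq> 0" using norm2_nonzero by (auto simp: pos_norm2_def vec_eq_iff)
  then show ?thesis unfolding height_def using v
    by (intro sum_pos2[of _ i]) (auto simp: pos_norm2_def less_le)
qed

section \<open>Paths and the absence of cycles\<close>

definition path_vec :: "'n list \<Rightarrow> real ^ 'n" where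
  "path_vec p = (\<Sum>l\<in>set p. simple_root l)"

definition simple_path :: "'n list \<Rightarrow> bool" where
  "simple_path p \<longleftrightarrow> distinct p \<and> successively E p"

lemma path_vec_nth: "path_vec p $ k = (if k \<in> set p then 1 else 0)"
  by (simp add: path_vec_def simple_root_nth)

lemma path_vec_Cons: "l \<notin> set p \<Longrightarrow> path_vec (l # p) = simple_root l + path_vec p"
  by (simp add: path_vec_def)

lemma integral_path_vec: "integral_vec (path_vec p)"
  by (simp add: path_vec_def integral_vec_intros)

lemma bform_simple_path_vec:
  "l \<notin> set p \<Longrightarrow> bform E (simple_root l) (path_vec p) = - real (card {k \<in> set p. E l k})"
proof -
  assume "l \<notin> set p"
  have "(\<Sum>j | E l j. path_vec p $ j) = (\<Sum>j | E l j \<and> j \<in> set p. 1)"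
    unfolding sum_over_Collect by (intro sum.cong) (auto simp: path_vec_nth)
  then show ?thesis using \<open>l \<notin> set p\<close>
    by (simp add: bform_simple path_vec_nth conj_commute)
qed

text \<open>
  A path with \<open>m\<close> vertices spans at least \<open>m - 1\<close> edges. That there are no more is a consequence of
positive definiteness, but the inequality suffices.
\<close>

lemma bform_path_vec_le_2: "simple_path p \<Longrightarrow> bform E (path_vec p) (path_vec p) \<le> 2"
proof (induction p)
  case (Cons l p)
  then have l: "l \<notin> set p" and p: "simple_path p"
    by (auto simp: simple_path_def successively_Cons)
  show ?case
  proof (cases p)
    case Nil
    then show ?thesis by (simp add: path_vec_def bform_simple_simple cartan_def)
  next
    case (Cons m q)
    then have "m \<in> {k \<in> set p. E l k}" using Cons.prems by (auto simp: simple_path_def)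
    then have "1 \<le> card {k \<in> set p. E l k}"
      by (metis card_0_eq empty_iff finite_code less_one not_less)
    then show ?thesis using Cons.IH[OF p] l
      by (simp add: path_vec_Cons bform_linear bform_simple_path_vec
          bform_sym[of "path_vec p" "simple_root l"] bform_simple_simple cartan_def)
  qed
qed (simp add: path_vec_def bform_linear)

text \<open>
  Adjoining to a path a vertex with two neighbours on it makes the form at most \<open>2 + 2 - 4 = 0\<close>.
\<close>

lemma no_cycle:
  assumes "simple_path p" "w \<notin> set p" "E w x" "E w y" "x \<in> set p" "y \<in> set p"
  shows "x = y"
proof (rule ccontr)
  assume "x \<noteq> y"
  have "card {x, y} \<le> card {k \<in> set p. E w k}"
    using assms by (intro card_mono) auto
  then have "bform E (path_vec (w # p)) (path_vec (w # p)) \<le> 0"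
    using bform_path_vec_le_2[OF assms(1)] assms(2) \<open>x \<noteq> y\<close>
    by (simp add: path_vec_Cons bform_linear bform_simple_path_vec
          bform_sym[of "path_vec p" "simple_root w"] bform_simple_simple cartan_def)
  moreover have "path_vec (w # p) $ w \<noteq> 0" by (simp add: path_vec_nth)
  then have "path_vec (w # p) \<noteq> 0" by auto
  ultimately show False using posdef by force
qed

end

section \<open>Coefficients of roots along the arms\<close>

locale star_diagram = posdef_diagram E
  for E :: "'n::finite \<Rightarrow> 'n \<Rightarrow> bool" +
  assumes degree_le_3: "card {j. E i j} \<le> 3"
    and branch_unique: "branch_vertex E b \<Longrightarrow> branch_vertex E c \<Longrightarrow> b = c"
begin

lemma simple_path_append:
  "simple_path (p @ q) \<longleftrightarrow> simple_path p \<and> simple_path q \<and> set p \<inter> set q = {} \<and>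
     (p \<noteq> [] \<longrightarrow> q \<noteq> [] \<longrightarrow> E (last p) (hd q))"
  by (auto simp: simple_path_def successively_append_iff)

lemma path_vec_append: "set p \<inter> set q = {} \<Longrightarrow> path_vec (p @ q) = path_vec p + path_vec q"
  by (simp add: path_vec_def sum.union_disjoint)

lemma nonbranch_neighbours:
  assumes "\<not> branch_vertex E v" "E v x" "E v y" "x \<noteq> y"
  shows "{j. E v j} = {x, y}"
proof -
  have "{x, y} = {j. E v j}"
    using assms by (intro card_seteq) (auto simp: branch_vertex_def)
  then show ?thesis by simp
qed

text \<open>
  Along vertices with two neighbours each, \<open>B(\<alpha>\<^sub>x, \<gamma>)\<close> is minus the second difference of the
coefficients of \<open>\<gamma>\<close>, so the sum telescopes to the increment entering the path minus the increment
leaving it.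
\<close>

lemma flux:
  assumes "simple_path (u # zs @ [w])" "\<forall>x\<in>set zs. \<not> branch_vertex E x"
  shows "bform E (path_vec zs) \<gamma> = (\<gamma> $ hd (zs @ [w]) - \<gamma> $ u) - (\<gamma> $ w - \<gamma> $ last (u # zs))"
  using assms
proof (induction zs arbitrary: u)
  case Nil
  then show ?case by (simp add: path_vec_def bform_linear)
next
  case (Cons v zs)
  let ?n = "hd (zs @ [w])"
  have p: "simple_path (v # zs @ [w])" "v \<notin> set zs" "E u v" "E v ?n" "?n \<noteq> u"
    using Cons.prems(1) by (cases zs; auto simp: simple_path_def)+
  have "{j. E v j} = {u, ?n}"
    using Cons.prems(2) p edge_sym by (intro nonbranch_neighbours) auto
  then have "bform E (simple_root v) \<gamma> = 2 * \<gamma> $ v - \<gamma> $ u - \<gamma> $ ?n"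
    using p(5) by (simp add: bform_simple)
  then show ?case
    using Cons.IH[OF p(1)] Cons.prems(2) p(2) by (simp add: path_vec_Cons bform_linear)
qed

lemma pos_norm2_ge_1: "pos_norm2 \<gamma> \<Longrightarrow> 0 < \<gamma> $ i \<Longrightarrow> 1 \<le> \<gamma> $ i"
  by (auto simp: pos_norm2_def norm2_def integral_vec_def intro: Ints_pos_ge_1)

lemma pos_norm2_less: "pos_norm2 \<gamma> \<Longrightarrow> \<gamma> $ i < \<gamma> $ j \<Longrightarrow> 1 \<le> \<gamma> $ j - \<gamma> $ i"
  by (auto simp: pos_norm2_def norm2_def integral_vec_def intro: Ints_pos_ge_1)

lemma bform_path_le_1:
  "pos_norm2 \<gamma> \<Longrightarrow> simple_path p \<Longrightarrow> path_vec p \<noteq> \<gamma> \<Longrightarrow> bform E (path_vec p) \<gamma> \<le> 1"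
  using bform_path_vec_le_2[of p]
  by (intro bform_le_1) (auto simp: pos_norm2_def norm2_def integral_path_vec)

text \<open>
  Walk away from \<open>P\<close> through vertices with positive coefficient, stopping at a branch vertex, for as
long as possible. If the walk does not reach a branch vertex, then all further neighbours of its end
have coefficient 0: a neighbour with positive coefficient would extend the walk, as it cannot lie on
the walk in the absence of cycles.
\<close>

lemma maximal_arm:
  assumes \<gamma>: "pos_norm2 \<gamma>" and P: "simple_path (P @ [v])" "P \<noteq> []" and v: "0 < \<gamma> $ v"
  obtains zs where "zs \<noteq> []" "hd zs = v" "simple_path (P @ zs)" "\<forall>x\<in>set zs. 0 < \<gamma> $ x"
    "\<forall>x\<in>set (butlast zs). \<not> branch_vertex E x"
    "branch_vertex E (last zs) \<or> (\<forall>k. E (last zs) k \<longrightarrow> k \<noteq> last (P @ butlast zs) \<longrightarrow> \<gamma> $ k = 0)"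
proof -
  define Z where "Z zs \<longleftrightarrow> zs \<noteq> [] \<and> hd zs = v \<and> simple_path (P @ zs) \<and> (\<forall>x\<in>set zs. 0 < \<gamma> $ x) \<and>
      (\<forall>x\<in>set (butlast zs). \<not> branch_vertex E x)" for zs
  have bound: "length zs < Suc CARD('n)" if "Z zs" for zs
  proof -
    have "distinct zs" using that by (auto simp: Z_def simple_path_def)
    then have "length zs = card (set zs)" by (simp add: distinct_card)
    also have "\<dots> \<le> CARD('n)" by (rule card_mono[OF finite subset_UNIV])
    finally show ?thesis by simp
  qed
  have "Z [v]" using P v by (simp add: Z_def)
  then obtain zs where zs: "Z zs" and max: "\<And>ys. Z ys \<Longrightarrow> length ys \<le> length zs"
    using ex_has_greatest_nat[of Z "[v]" length "Suc CARD('n)"] bound by blast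
  have "\<gamma> $ k = 0"
    if nb: "\<not> branch_vertex E (last zs)" and k: "E (last zs) k" "k \<noteq> last (P @ butlast zs)" for k
  proof (rule ccontr)
    assume "\<gamma> $ k \<noteq> 0"
    then have kpos: "0 < \<gamma> $ k" using \<gamma> by (auto simp: pos_norm2_def less_le)
    have split: "P @ zs = (P @ butlast zs) @ [last zs]" using zs by (simp add: Z_def)
    have path: "simple_path ((P @ butlast zs) @ [last zs])" using zs split unfolding Z_def by metis
    then have "E (last zs) (last (P @ butlast zs))"
      using P(2) edge_sym unfolding simple_path_append[of "P @ butlast zs"] by simp
    then have "k \<notin> set (P @ butlast zs)"
      using no_cycle[of "P @ butlast zs" "last zs" k "last (P @ butlast zs)"] path k P(2) last_in_set[of "P @ butlast zs"]
      unfolding simple_path_append[of "P @ butlast zs"] by auto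
    then have "k \<notin> set (P @ zs)" using k(1) edge_irrefl unfolding split by auto
    moreover have "\<not> branch_vertex E x" if "x \<in> set zs" for x
      using that nb zs append_butlast_last_id[of zs] unfolding Z_def
      by (metis Un_iff empty_iff list.set(1) set_ConsD set_append)
    ultimately have "Z (zs @ [k])"
      using zs kpos k(1) unfolding Z_def append_assoc[symmetric] simple_path_append[of "P @ zs"]
      by (auto simp: simple_path_def[of "[k]"])
    then show False using max[of "zs @ [k]"] by simp
  qed
  then show ?thesis using that[of zs] zs by (auto simp: Z_def)
qed

text \<open>
  In the closed case the telescoping sum ends at coefficient 0, which contributes the coefficient of the
last vertex and hence at least 1.
\<close>

lemma arm_cases:
  assumes \<gamma>: "pos_norm2 \<gamma>" and P: "simple_path (P @ [v])" "P \<noteq> []" and v: "0 < \<gamma> $ v"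
  obtains (closed) zs where "simple_path (P @ zs)" "hd zs = v" "zs \<noteq> []"
      "\<gamma> $ v - \<gamma> $ last P + 1 \<le> bform E (path_vec zs) \<gamma>"
    | (branch) ys b where "simple_path (P @ ys @ [b])" "hd (ys @ [b]) = v" "branch_vertex E b"
      "\<forall>x\<in>set ys. \<not> branch_vertex E x"
proof -
  obtain zs where zs: "zs \<noteq> []" "hd zs = v" "simple_path (P @ zs)" "\<forall>x\<in>set zs. 0 < \<gamma> $ x"
    and nb: "\<forall>x\<in>set (butlast zs). \<not> branch_vertex E x"
    and alt: "branch_vertex E (last zs) \<or> (\<forall>k. E (last zs) k \<longrightarrow> k \<noteq> last (P @ butlast zs) \<longrightarrow> \<gamma> $ k = 0)"
    using maximal_arm[OF assms] by blast
  obtain ys e where ye: "zs = ys @ [e]" using zs(1) by (metis append_butlast_last_id)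
  show ?thesis
  proof (cases "branch_vertex E e")
    case True
    then show ?thesis using branch[of ys e] zs nb ye by simp
  next
    case False
    let ?q = "last (last P # ys)"
    have q: "last (P @ ys) = ?q" by simp
    \<comment> \<open>The vertex before \<open>e\<close>, which is the last vertex of \<open>P\<close> if the arm consists of \<open>e\<close> alone.\<close>
    have ze: "\<gamma> $ k = 0" if "E e k" "k \<noteq> ?q" for k
      using alt False that ye unfolding q[symmetric] by simp
    have path: "simple_path (last P # ys @ [e])"
    proof -
      have "P @ zs = butlast P @ (last P # ys @ [e])" using P(2) ye by simp
      then show ?thesis using zs(3) simple_path_append[of "butlast P"] by metis
    qed
    have "simple_path ((last P # ys) @ [e])" using path by simp
    then have qe: "E e ?q" using edge_sym unfolding simple_path_append[of "last P # ys"] by simp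
    have "(\<Sum>j | E e j. \<gamma> $ j) = (\<Sum>j | E e j. if j = ?q then \<gamma> $ ?q else 0)"
      using ze by (intro sum.cong) auto
    then have "bform E (simple_root e) \<gamma> = 2 * \<gamma> $ e - \<gamma> $ ?q"
      using qe by (simp add: bform_simple)
    moreover have "bform E (path_vec ys) \<gamma> = \<gamma> $ v - \<gamma> $ last P - (\<gamma> $ e - \<gamma> $ ?q)"
      using flux[OF path, of \<gamma>] nb zs(2) ye by simp
    moreover have "path_vec zs = path_vec ys + simple_root e"
      using path ye by (subst ye, subst path_vec_append) (auto simp: simple_path_def path_vec_def)
    moreover have "1 \<le> \<gamma> $ e" using pos_norm2_ge_1[OF \<gamma>] zs(4) ye by simp
    ultimately have "\<gamma> $ v - \<gamma> $ last P + 1 \<le> bform E (path_vec zs) \<gamma>"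
      by (simp add: bform_linear)
    then show ?thesis using closed[of zs] zs by simp
  qed
qed

lemma orth_neighbour_sum:
  "bform E (simple_root i) \<gamma> = 0 \<Longrightarrow> (\<Sum>j | E i j. \<gamma> $ j) = 2 * \<gamma> $ i"
  by (simp add: bform_simple)

text \<open>
  Otherwise the closed arm starting at \<open>j\<close> pairs with \<open>\<gamma>\<close> to at least 2, so it is \<open>\<gamma>\<close> itself. Then
\<open>\<gamma>\<close> vanishes at \<open>i\<close> but not at its neighbour \<open>j\<close>, and orthogonality fails. A non-closed arm would
lead to a second branch vertex.
\<close>

lemma branch_dominates:
  assumes \<gamma>: "pos_norm2 \<gamma>" and orth: "bform E (simple_root i) \<gamma> = 0"
    and "branch_vertex E i" "E i j"
  shows "\<gamma> $ j \<le> \<gamma> $ i"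
proof (rule ccontr)
  assume *: "\<not> ?thesis"
  have nn: "0 \<le> \<gamma> $ k" for k using \<gamma> by (simp add: pos_norm2_def)
  have j0: "0 < \<gamma> $ j" using * nn[of i] by simp
  have path: "simple_path ([i] @ [j])" using assms(4) edge_irrefl by (auto simp: simple_path_def)
  show False
  proof (rule arm_cases[OF \<gamma> path _ j0])
    fix zs assume zs: "simple_path ([i] @ zs)" "\<gamma> $ j - \<gamma> $ last [i] + 1 \<le> bform E (path_vec zs) \<gamma>"
    have "1 \<le> \<gamma> $ j - \<gamma> $ i" using * pos_norm2_less[OF \<gamma>, of i j] by simp
    then have "path_vec zs = \<gamma>"
      using bform_path_le_1[OF \<gamma>, of zs] zs simple_path_append[of "[i]" zs] by fastforce
    then have "\<gamma> $ i = 0" using zs(1) path_vec_nth[of zs i] by (auto simp: simple_path_def)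
    moreover have "\<gamma> $ j \<le> (\<Sum>k | E i k. \<gamma> $ k)"
      using assms(4) nn by (intro member_le_sum) auto
    ultimately show False using orth_neighbour_sum[OF orth] j0 by simp
  next
    fix ys b assume "simple_path ([i] @ ys @ [b])" "branch_vertex E b"
    then show False using branch_unique[of i b] assms(3) by (auto simp: simple_path_def)
  qed simp
qed

text \<open>
  A direction in which the coefficients increase must lead to the branch vertex, and they never decrease
on the way: by the flux formula an initial piece of the way would otherwise pair with \<open>\<gamma>\<close> to at
least 2. The assumption \<open>2 \<le> \<gamma> $ h\<close> keeps \<open>\<gamma>\<close> distinct from all path vectors, which have
coefficients 0 and 1.
\<close>

lemma climb:
  assumes \<gamma>: "pos_norm2 \<gamma>" and "E i h" "\<gamma> $ i < \<gamma> $ h" "2 \<le> \<gamma> $ h"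
  obtains ys b where "simple_path (i # ys @ [b])" "hd (ys @ [b]) = h" "branch_vertex E b"
      "\<forall>x\<in>set ys. \<not> branch_vertex E x" "\<forall>x\<in>set (ys @ [b]). \<gamma> $ h \<le> \<gamma> $ x"
proof -
  have d: "1 \<le> \<gamma> $ h - \<gamma> $ i" using assms(3) pos_norm2_less[OF \<gamma>, of i h] by simp
  have ne: "path_vec p \<noteq> \<gamma>" for p
    using assms(4) path_vec_nth[of p h] by (auto split: if_splits)
  have path: "simple_path ([i] @ [h])" using assms(2) edge_irrefl by (auto simp: simple_path_def)
  have h0: "0 < \<gamma> $ h" using assms(4) by simp
  show ?thesis
  proof (rule arm_cases[OF \<gamma> path _ h0])
    fix zs assume zs: "simple_path ([i] @ zs)" "\<gamma> $ h - \<gamma> $ last [i] + 1 \<le> bform E (path_vec zs) \<gamma>"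
    then show ?thesis
      using bform_path_le_1[OF \<gamma> _ ne, of zs] d simple_path_append[of "[i]" zs] by fastforce
  next
    fix ys b assume y: "simple_path ([i] @ ys @ [b])" "hd (ys @ [b]) = h" "branch_vertex E b"
      "\<forall>x\<in>set ys. \<not> branch_vertex E x"
    have "\<gamma> $ h \<le> \<gamma> $ ((ys @ [b]) ! n)" if "n \<le> length ys" for n
      using that
    proof (induction n)
      case 0
      then show ?case using y(2) by (simp add: hd_conv_nth)
    next
      case (Suc n)
      let ?xs = "take (Suc n) ys" and ?w = "(ys @ [b]) ! Suc n"
      have eq: "[i] @ ys @ [b] = (i # ?xs @ [?w]) @ drop (Suc (Suc n)) (ys @ [b])"
        using Suc.prems id_take_nth_drop[of "Suc n" "ys @ [b]"] by simp
      have p: "simple_path (i # ?xs @ [?w])"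
        using y(1) unfolding eq simple_path_append[of "i # ?xs @ [?w]"] by simp
      have ne0: "?xs \<noteq> []" using Suc.prems by auto
      have hd: "hd (?xs @ [?w]) = h" using y(2) Suc.prems by (cases ys) auto
      have last: "last (i # ?xs) = (ys @ [b]) ! n"
        using Suc.prems ne0 by (simp add: last_conv_nth nth_append min_def)
      have "bform E (path_vec ?xs) \<gamma> = \<gamma> $ h - \<gamma> $ i - (\<gamma> $ ?w - \<gamma> $ ((ys @ [b]) ! n))"
        using flux[OF p, of \<gamma>] y(4) hd last in_set_takeD by metis
      moreover have "simple_path ?xs"
        using p simple_path_append[of "[i]" "?xs @ [?w]"] simple_path_append[of ?xs "[?w]"] by simp
      then have "bform E (path_vec ?xs) \<gamma> \<le> 1" using bform_path_le_1[OF \<gamma> _ ne] by blast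
      ultimately show ?case using Suc d by simp
    qed
    then have "\<forall>x\<in>set (ys @ [b]). \<gamma> $ h \<le> \<gamma> $ x"
      by (metis in_set_conv_nth length_append_singleton less_Suc_eq_le)
    then show ?thesis using that[of ys b] y by simp
  qed simp
qed

text \<open>
  The increment \<open>\<gamma> $ h - \<gamma> $ i\<close> entering the path from \<open>h\<close> to \<open>b\<close> must not pair with the path to
more than 1, and what leaves it is controlled by the other two neighbours \<open>r\<close> and \<open>q\<close> of \<open>b\<close>. The
contribution of \<open>q\<close> is removed by continuing the path through \<open>q\<close> until the coefficients reach 0,
which leaves only \<open>r\<close>.
\<close>

lemma beyond_branch:
  assumes \<gamma>: "pos_norm2 \<gamma>" and "2 \<le> \<gamma> $ h"
    and path: "simple_path (i # ys @ [b])" "hd (ys @ [b]) = h" and b: "branch_vertex E b"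
    and nb: "\<forall>x\<in>set ys. \<not> branch_vertex E x" and ge: "\<gamma> $ h \<le> \<gamma> $ b"
    and r: "E b r" "r \<notin> set (i # ys @ [b])"
  shows "\<gamma> $ h - \<gamma> $ i \<le> \<gamma> $ r"
proof -
  have ne: "path_vec p \<noteq> \<gamma>" for p
    using assms(2) path_vec_nth[of p h] by (auto split: if_splits)
  let ?l = "last (i # ys)"
  have p1: "simple_path (i # ys)" "b \<notin> set (i # ys)" "E b ?l" and l: "?l \<in> set (i # ys)"
    using path(1) simple_path_append[of "i # ys" "[b]"] edge_sym last_in_set[of "i # ys"] by auto
  have "r \<noteq> ?l" using r l by auto
  have "card {j. E b j} = 3" using b degree_le_3[of b] by (simp add: branch_vertex_def)
  then have "card ({j. E b j} - {r, ?l}) = 1"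
    using r p1 \<open>r \<noteq> ?l\<close> by (subst card_Diff_subset) auto
  then obtain q where q: "{j. E b j} - {r, ?l} = {q}" by (auto simp: card_1_singleton_iff)
  have nbrs: "{j. E b j} = {r, ?l, q}" "q \<noteq> r" "q \<noteq> ?l" "E b q" using q r(1) p1(3) by blast+
  have qb: "q \<notin> set (i # ys @ [b])"
    using no_cycle[OF p1(1,2), of q ?l] nbrs p1(3) l edge_irrefl by auto
  have "bform E (simple_root b) \<gamma> = 2 * \<gamma> $ b - \<gamma> $ r - \<gamma> $ ?l - \<gamma> $ q"
    using nbrs(2,3) \<open>r \<noteq> ?l\<close> unfolding bform_simple nbrs(1) by simp
  moreover have "bform E (path_vec ys) \<gamma> = \<gamma> $ h - \<gamma> $ i - (\<gamma> $ b - \<gamma> $ ?l)"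
    using flux[OF path(1) nb, of \<gamma>] path(2) by simp
  moreover have "path_vec (ys @ [b]) = path_vec ys + simple_root b"
    using path(1) by (subst path_vec_append) (auto simp: simple_path_def path_vec_def)
  ultimately have B: "bform E (path_vec (ys @ [b])) \<gamma> = \<gamma> $ h - \<gamma> $ i + \<gamma> $ b - \<gamma> $ r - \<gamma> $ q"
    by (simp add: bform_linear)
  have pb: "simple_path (ys @ [b])" using path(1) simple_path_append[of "[i]" "ys @ [b]"] by simp
  show ?thesis
  proof (cases "\<gamma> $ q = 0")
    case True
    then show ?thesis using B bform_path_le_1[OF \<gamma> pb ne] ge assms(2) by simp
  next
    case False
    then have q0: "0 < \<gamma> $ q" using \<gamma> by (auto simp: pos_norm2_def less_le)
    have pq: "simple_path ((i # ys @ [b]) @ [q])"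
      using path(1) qb nbrs(4) unfolding simple_path_append[of "i # ys @ [b]"] by (auto simp: simple_path_def[of "[q]"])
    show ?thesis
    proof (rule arm_cases[OF \<gamma> pq _ q0])
      fix zs assume zs: "simple_path ((i # ys @ [b]) @ zs)"
        "\<gamma> $ q - \<gamma> $ last (i # ys @ [b]) + 1 \<le> bform E (path_vec zs) \<gamma>"
      then have p: "simple_path ((ys @ [b]) @ zs)" and dis: "set (ys @ [b]) \<inter> set zs = {}"
        using simple_path_append[of "[i]" "(ys @ [b]) @ zs"] simple_path_append[of "ys @ [b]" zs] by simp_all
      show ?thesis
        using B zs(2) bform_path_le_1[OF \<gamma> p ne] path_vec_append[OF dis] by (simp add: bform_linear)
    next
      fix xs c assume "simple_path ((i # ys @ [b]) @ xs @ [c])" "branch_vertex E c"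
      then show ?thesis using branch_unique[OF b] by (auto simp: simple_path_def)
    qed simp
  qed
qed

end

section \<open>Decomposition into elementary roots\<close>

text \<open>
  Generation by single additions makes linear images of the cone easy; the coefficients are recovered
afterwards for a finite generating set.
\<close>

inductive_set nat_cone :: "'a::real_vector set \<Rightarrow> 'a set" for B where
  zero: "0 \<in> nat_cone B"
| add_gen: "v \<in> nat_cone B \<Longrightarrow> b \<in> B \<Longrightarrow> v + b \<in> nat_cone B"

lemma nat_cone_gen: "b \<in> B \<Longrightarrow> b \<in> nat_cone B"
  using nat_cone.add_gen[OF nat_cone.zero] by simp

lemma nat_cone_add: "u \<in> nat_cone B \<Longrightarrow> v \<in> nat_cone B \<Longrightarrow> u + v \<in> nat_cone B"
  by (rotate_tac, induction rule: nat_cone.induct) (auto simp: add.assoc[symmetric] intro: nat_cone.intros)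

lemma nat_cone_sum: "(\<And>k. k \<in> S \<Longrightarrow> f k \<in> nat_cone B) \<Longrightarrow> (\<Sum>k\<in>S. f k) \<in> nat_cone B"
  by (induction S rule: infinite_finite_induct) (auto intro: nat_cone.zero nat_cone_add)

lemma nat_cone_scale:
  assumes "a \<in> \<int>" "0 \<le> a" "v \<in> nat_cone B"
  shows "a *\<^sub>R v \<in> nat_cone B"
proof -
  obtain n where "a = real n" using assms(1,2) by (metis Ints_cases of_int_0_le_iff zero_le_imp_eq_int of_int_of_nat_eq)
  moreover have "real n *\<^sub>R v \<in> nat_cone B"
    by (induction n) (auto simp: scaleR_left.add algebra_simps intro: nat_cone.zero nat_cone_add assms(3))
  ultimately show ?thesis by simp
qed

lemma card_le_3_cases:
  assumes "finite S" "card S \<le> 3"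
  obtains "S = {}" | x where "S = {x}" | x y where "S = {x, y}" "x \<noteq> y"
    | x y z where "S = {x, y, z}" "x \<noteq> y" "y \<noteq> z" "x \<noteq> z"
proof -
  consider "card S = 0" | "card S = 1" | "card S = 2" | "card S = 3" using assms(2) by linarith
  then show ?thesis
    using assms(1) that by cases (auto simp: card_1_singleton_iff card_2_iff card_3_iff)
qed

context star_diagram
begin

lemma sum_simple_roots_nth:
  "(\<Sum>l\<in>S. c l *\<^sub>R simple_root l) $ k = (if k \<in> S then c k else (0::real))" for S :: "'n set"
  by (simp add: simple_root_nth if_distrib cong: if_cong)

lemma highest_root_D_nth:
  "highest_root_D E S $ k = (if k \<in> S then if card {j \<in> S. E k j} = 1 then 1 else 2 else 0)"
  unfolding highest_root_D_def sum_simple_roots_nth by simp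

text \<open>
  The absence of cycles ensures that the vertices on the path and the neighbours of the branch vertex
span no edges except the obvious ones, so that the endpoints of this subdiagram are \<open>i\<close> and the
neighbours of \<open>b\<close> off the path.
\<close>

lemma theta_coefficients:
  fixes i ys b
  defines "S \<equiv> set (i # ys @ [b]) \<union> {j. E b j}"
  assumes path: "simple_path (i # ys @ [b])" and b: "branch_vertex E b"
  shows "elementary E i (highest_root_D E S)"
    and "highest_root_D E S $ i = 1"
    and "highest_root_D E S $ hd (ys @ [b]) = 2"
    and "\<And>j. E i j \<Longrightarrow> j \<noteq> hd (ys @ [b]) \<Longrightarrow> highest_root_D E S $ j = 0"
    and "\<And>r. E b r \<Longrightarrow> r \<notin> set (i # ys @ [b]) \<Longrightarrow> highest_root_D E S $ r = 1"
proof -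
  let ?h = "hd (ys @ [b])"
  let ?p = "i # ys @ [b]"
  have ib: "i \<noteq> b" using path by (auto simp: simple_path_def)
  have ih: "E i ?h" "i \<notin> set (ys @ [b])" and py: "simple_path (ys @ [b])"
    using path simple_path_append[of "[i]" "ys @ [b]"] by auto
  have hin: "?h \<in> set (ys @ [b])" by (rule hd_in_set) simp
  have "path_between E i ?p b" using path by (simp add: path_between_def simple_path_def)
  then show "elementary E i (highest_root_D E S)"
    unfolding S_def using elementary.branch[OF b ib] by blast
  have off: "j \<notin> S" if j: "E i j" "j \<noteq> ?h" for j
  proof
    assume "j \<in> S"
    moreover have "j \<notin> set (ys @ [b])" using no_cycle[OF py ih(2) j(1) ih(1)] j(2) hin by blast
    moreover have "j \<noteq> i" using j edge_irrefl by auto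
    ultimately have "E b j" "j \<notin> set ?p" by (auto simp: S_def)
    then have "b = i" using no_cycle[OF path, of j b i] edge_sym j(1) by auto
    then show False using ib by simp
  qed
  have "{j \<in> S. E i j} = {?h}" using off ih(1) hin by (auto simp: S_def)
  then show "highest_root_D E S $ i = 1" by (simp add: highest_root_D_nth S_def)
  show "highest_root_D E S $ j = 0" if "E i j" "j \<noteq> ?h" for j
    using off[OF that] by (simp add: highest_root_D_nth)
  show "highest_root_D E S $ ?h = 2"
  proof -
    have "card {j \<in> S. E ?h j} \<noteq> 1"
    proof (cases ys)
      case Nil
      have "{j \<in> S. E ?h j} = {j. E b j}" using Nil by (auto simp: S_def)
      then show ?thesis using b by (simp add: branch_vertex_def)
    next
      case (Cons y zs)
      let ?n = "hd (zs @ [b])"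
      have "?n \<in> set (zs @ [b])" by (rule hd_in_set) simp
      moreover have "E ?h ?n" using path Cons by (cases zs) (auto simp: simple_path_def)
      ultimately have "{i, ?n} \<subseteq> {j \<in> S. E ?h j}" "i \<noteq> ?n"
        using Cons ih edge_sym by (auto simp: S_def)
      then have "2 \<le> card {j \<in> S. E ?h j}" using card_mono[of "{j \<in> S. E ?h j}" "{i, ?n}"] by simp
      then show ?thesis by simp
    qed
    moreover have "?h \<in> S" using hin by (auto simp: S_def)
    ultimately show ?thesis by (simp add: highest_root_D_nth)
  qed
  show "highest_root_D E S $ r = 1" if r: "E b r" "r \<notin> set ?p" for r
  proof -
    have "k = b" if k: "k \<in> S" "E r k" for k
    proof (cases "k \<in> set ?p")
      case True
      then show ?thesis using no_cycle[OF path r(2) k(2), of b] edge_sym[OF r(1)] by simp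
    next
      case False
      then have bk: "E b k" "k \<noteq> b" using k(1) by (auto simp: S_def)
      have "simple_path [b, k]" using bk by (auto simp: simple_path_def)
      then show ?thesis
        using no_cycle[of "[b, k]" r k b] k(2) edge_sym[OF r(1)] r edge_irrefl by auto
    qed
    then have "{j \<in> S. E r j} = {b}" using edge_sym[OF r(1)] by (auto simp: S_def)
    then show ?thesis using r(1) by (simp add: highest_root_D_nth S_def)
  qed
qed

abbreviation elementary_cone :: "'n \<Rightarrow> (real ^ 'n) set" where
  "elementary_cone i \<equiv> nat_cone {\<beta>. elementary E i \<beta>}"

text \<open>
  Such a vector involves only simple roots orthogonal to \<open>\<alpha>\<^sub>i\<close>, and these are elementary.
\<close>

lemma far_vector_in_cone:
  assumes "integral_vec v" "\<And>k. 0 \<le> v $ k" "v $ i = 0" "\<And>j. E i j \<Longrightarrow> v $ j = 0"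
  shows "v \<in> elementary_cone i"
proof -
  have "v $ k *\<^sub>R simple_root k \<in> elementary_cone i" for k
  proof (cases "k = i \<or> E i k")
    case True
    then show ?thesis using assms nat_cone.zero by auto
  next
    case False
    then show ?thesis using assms(1,2)
      by (intro nat_cone_scale nat_cone_gen) (auto simp: integral_vec_def intro: elementary.simple)
  qed
  then have "(\<Sum>k\<in>UNIV. v $ k *\<^sub>R simple_root k) \<in> elementary_cone i" by (intro nat_cone_sum)
  then show ?thesis using vec_eq_sum_simple_roots[of v] by simp
qed

lemma integral_vec_elementary: "elementary E i \<beta> \<Longrightarrow> integral_vec \<beta>"
  by (auto elim!: elementary.cases simp: integral_vec_def simple_root_nth highest_root_D_nth)

lemma integral_vec_cone: "v \<in> elementary_cone i \<Longrightarrow> integral_vec v"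
  by (induction rule: nat_cone.induct)
    (auto simp: integral_vec_elementary intro: integral_vec_add, simp add: integral_vec_def)

lemma in_cone_by_subtraction:
  assumes "integral_vec v" "u \<in> elementary_cone i" "\<And>k. u $ k \<le> v $ k" "u $ i = v $ i"
    "\<And>j. E i j \<Longrightarrow> u $ j = v $ j"
  shows "v \<in> elementary_cone i"
proof -
  have "v - u \<in> elementary_cone i"
    using assms integral_vec_cone[OF assms(2)]
    by (intro far_vector_in_cone integral_vec_diff) auto
  then show ?thesis using nat_cone_add[OF assms(2), of "v - u"] by simp
qed

abbreviation path_root :: "'n \<Rightarrow> 'n \<Rightarrow> 'n \<Rightarrow> real ^ 'n" where
  "path_root h i j \<equiv> simple_root h + simple_root i + simple_root j"

lemma path_root_in_cone:
  "h \<noteq> j \<Longrightarrow> E i h \<Longrightarrow> E i j \<Longrightarrow> a \<in> \<int> \<Longrightarrow> 0 \<le> a \<Longrightarrow> a *\<^sub>R path_root h i j \<in> elementary_cone i"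
  by (intro nat_cone_scale nat_cone_gen) (auto intro: elementary.path edge_sym)

text \<open>
  Path roots suffice here. If \<open>i\<close> has at most one neighbour, the coefficients at
\<open>i\<close> and its neighbour vanish; with two neighbours they all agree, and \<open>\<gamma> $ i\<close> copies of the path root
remove them. With three neighbours \<open>x\<close>, \<open>y\<close>, \<open>z\<close>, the equation
\<open>\<gamma> $ x + \<gamma> $ y + \<gamma> $ z = 2 * \<gamma> $ i\<close> determines how often each of the three path roots is used, and
domination says that these numbers are nonnegative.
\<close>

lemma cone_if_dominated:
  assumes \<gamma>: "pos_norm2 \<gamma>" and orth: "bform E (simple_root i) \<gamma> = 0"
    and dom: "\<And>j. E i j \<Longrightarrow> \<gamma> $ j \<le> \<gamma> $ i"
  shows "\<gamma> \<in> elementary_cone i"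
proof -
  have int: "integral_vec \<gamma>" and nn: "\<And>k. 0 \<le> \<gamma> $ k"
    using \<gamma> by (auto simp: pos_norm2_def norm2_def)
  then have Z: "\<gamma> $ k \<in> \<int>" for k by (simp add: integral_vec_def)
  note sum = orth_neighbour_sum[OF orth]
  show ?thesis
  proof (rule card_le_3_cases[of "{j. E i j}"])
    assume N: "{j. E i j} = {}"
    then show ?thesis using sum int nn by (intro far_vector_in_cone) auto
  next
    fix x assume N: "{j. E i j} = {x}"
    then have "E i x" by auto
    then have "\<gamma> $ x = 0" "\<gamma> $ i = 0" using sum N dom[of x] nn[of x] by auto
    moreover have "j = x" if "E i j" for j using that N by blast
    ultimately show ?thesis using int nn by (intro far_vector_in_cone) auto
  next
    fix x y assume N: "{j. E i j} = {x, y}" "x \<noteq> y"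
    then have e: "E i x" "E i y" by auto
    then have eq: "\<gamma> $ x = \<gamma> $ i" "\<gamma> $ y = \<gamma> $ i" using sum N dom[of x] dom[of y] by auto
    have "x \<noteq> i" "y \<noteq> i" using e edge_irrefl by auto
    then show ?thesis
      using N eq nn int Z path_root_in_cone[of x y i "\<gamma> $ i"] e
      by (intro in_cone_by_subtraction[of \<gamma> "\<gamma> $ i *\<^sub>R path_root x i y"]) (auto simp: simple_root_nth)
  next
    fix x y z assume N: "{j. E i j} = {x, y, z}" "x \<noteq> y" "y \<noteq> z" "x \<noteq> z"
    then have e: "E i x" "E i y" "E i z" by auto
    let ?u = "(\<gamma> $ i - \<gamma> $ z) *\<^sub>R path_root x i y + (\<gamma> $ i - \<gamma> $ y) *\<^sub>R path_root x i z +
      (\<gamma> $ i - \<gamma> $ x) *\<^sub>R path_root y i z"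
    have s: "\<gamma> $ x + \<gamma> $ y + \<gamma> $ z = 2 * \<gamma> $ i" using sum N by simp
    have ne: "x \<noteq> i" "y \<noteq> i" "z \<noteq> i" using e edge_irrefl by auto
    have "?u \<in> elementary_cone i"
      using N e Z dom by (intro nat_cone_add path_root_in_cone) auto
    then show ?thesis
      using N ne s nn int by (intro in_cone_by_subtraction[of \<gamma> ?u]) (auto simp: simple_root_nth)
  qed (use degree_le_3 in auto)
qed

text \<open>
  The elementary roots generate all positive roots orthogonal to \<open>\<alpha>\<^sub>i\<close>. If the coefficient
increases from \<open>i\<close> to a neighbour \<open>h\<close>, by \<open>a\<close> say, then \<open>i\<close> is not the branch vertex, and orthogonality
makes the coefficient at the remaining neighbour, if any, smaller by the same \<open>a\<close>. Removing
\<open>a\<close> copies of \<open>\<theta>\<^sub>i\<close> and \<open>\<gamma> $ i - a\<close> copies of the path root clears \<open>i\<close> and its neighbours.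
The other coefficients stay nonnegative: on the way to the branch vertex they are at least
\<open>\<gamma> $ h \<ge> 2 * a\<close>, and beyond it at least \<open>a\<close>.
\<close>

lemma orthogonal_in_elementary_cone:
  assumes \<gamma>: "pos_norm2 \<gamma>" and orth: "bform E (simple_root i) \<gamma> = 0"
  shows "\<gamma> \<in> elementary_cone i"
proof (cases "\<forall>j. E i j \<longrightarrow> \<gamma> $ j \<le> \<gamma> $ i")
  case True
  then show ?thesis using cone_if_dominated[OF assms] by blast
next
  case False
  then obtain h where h: "E i h" "\<gamma> $ i < \<gamma> $ h" by auto
  have int: "integral_vec \<gamma>" and nn: "\<And>k. 0 \<le> \<gamma> $ k"
    using \<gamma> by (auto simp: pos_norm2_def norm2_def)
  then have Z: "\<gamma> $ k \<in> \<int>" for k by (simp add: integral_vec_def)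
  define a where "a = \<gamma> $ h - \<gamma> $ i"
  have a: "1 \<le> a" "a \<in> \<int>" using pos_norm2_less[OF \<gamma> h(2)] Z by (auto simp: a_def)
  note sum = orth_neighbour_sum[OF orth]
  have ih: "i \<noteq> h" using h edge_irrefl by auto
  have nbi: "\<not> branch_vertex E i" using branch_dominates[OF \<gamma> orth _ h(1)] h(2) by auto
  \<comment> \<open>The multiple of the path root; it is 0 if \<open>i\<close> is an endpoint of the diagram.\<close>
  obtain u where u: "u \<in> elementary_cone i" "u $ i = \<gamma> $ i - a" "u $ h = \<gamma> $ i - a"
    "\<And>j. E i j \<Longrightarrow> j \<noteq> h \<Longrightarrow> u $ j = \<gamma> $ j" "\<And>k. k \<noteq> i \<Longrightarrow> \<not> E i k \<Longrightarrow> u $ k = 0"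
    "0 \<le> \<gamma> $ i - a"
  proof (cases "{j. E i j} = {h}")
    case True
    then have "\<gamma> $ h = 2 * \<gamma> $ i" using sum by simp
    then show ?thesis using True by (intro that[of 0]) (auto simp: a_def intro: nat_cone.zero)
  next
    case False
    then obtain j where j: "E i j" "j \<noteq> h" using h by auto
    then have N: "{j. E i j} = {h, j}" using nonbranch_neighbours[OF nbi h(1) j(1)] by simp
    then have eq: "\<gamma> $ j = \<gamma> $ i - a" using sum j(2) by (simp add: a_def)
    have "j \<noteq> i" using j edge_irrefl by auto
    moreover have "\<gamma> $ j *\<^sub>R path_root h i j \<in> elementary_cone i"
      using j h Z nn by (intro path_root_in_cone) auto
    moreover have "k = h \<or> k = j" if "E i k" for k using that N by blast
    ultimately show ?thesis
      using ih h j eq nn[of j]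
      by (intro that[of "\<gamma> $ j *\<^sub>R path_root h i j"]) (auto simp: simple_root_nth)
  qed
  have h2: "\<gamma> $ h = \<gamma> $ i - a + 2 * a" by (simp add: a_def)
  then have "2 \<le> \<gamma> $ h" using u(6) a by linarith
  then obtain ys b where y: "simple_path (i # ys @ [b])" "hd (ys @ [b]) = h" "branch_vertex E b"
      "\<forall>x\<in>set ys. \<not> branch_vertex E x" "\<forall>x\<in>set (ys @ [b]). \<gamma> $ h \<le> \<gamma> $ x"
    using climb[OF \<gamma> h] by blast
  define S where "S = set (i # ys @ [b]) \<union> {j. E b j}"
  note \<theta> = theta_coefficients[OF y(1,3), folded S_def, unfolded y(2)]
  let ?\<theta> = "highest_root_D E S"
  have "a *\<^sub>R ?\<theta> + u \<in> elementary_cone i"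
    using a \<theta>(1) u(1) by (intro nat_cone_add[OF nat_cone_scale[OF _ _ nat_cone_gen]]) auto
  then show ?thesis
  proof (rule in_cone_by_subtraction[OF int])
    show "(a *\<^sub>R ?\<theta> + u) $ i = \<gamma> $ i" using \<theta>(2) u(2) by simp
    show nbr: "(a *\<^sub>R ?\<theta> + u) $ j = \<gamma> $ j" if "E i j" for j
      using \<theta>(3,4) u(3,4) h2 that by (cases "j = h") auto
    show "(a *\<^sub>R ?\<theta> + u) $ k \<le> \<gamma> $ k" for k
    proof (cases "k = i \<or> E i k")
      case True
      then show ?thesis using nbr \<theta>(2) u(2) by auto
    next
      case False
      then have uk: "u $ k = 0" using u(5) by auto
      consider "k \<notin> S" | "k \<in> set (ys @ [b])" | "E b k" "k \<notin> set (i # ys @ [b])"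
        using False unfolding S_def by auto
      then have "a * ?\<theta> $ k \<le> \<gamma> $ k"
      proof cases
        case 1
        then show ?thesis using nn by (simp add: highest_root_D_nth)
      next
        case 2
        have "?\<theta> $ k \<le> 2" by (simp add: highest_root_D_nth)
        then have "a * ?\<theta> $ k \<le> a * 2" using a by (intro mult_left_mono) auto
        also have "\<dots> \<le> \<gamma> $ h" using h2 u(6) by simp
        also have "\<dots> \<le> \<gamma> $ k" using y(5) 2 by blast
        finally show ?thesis .
      next
        case 3
        have "\<gamma> $ h \<le> \<gamma> $ b" using y(5) by simp
        then show ?thesis
          using beyond_branch[OF \<gamma> \<open>2 \<le> \<gamma> $ h\<close> y(1,2,3,4) _ 3] \<theta>(5)[OF 3] by (simp add: a_def)
      qed
      then show ?thesis using uk by simp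
    qed
  qed
qed

end

section \<open>The lattice and the order of the canonical basis\<close>

lemma vee_sym: "vee u v = vee v u"
  by (simp add: vee_def add.commute)

lemma vee_linear:
  "vee u (v + w) = vee u v + vee u w" "vee u (v - w) = vee u v - vee u w"
  "vee (v + w) u = vee v u + vee w u" "vee (v - w) u = vee v u - vee w u"
  "vee u (a *\<^sub>R v) = a *\<^sub>R vee u v" "vee (a *\<^sub>R v) u = a *\<^sub>R vee v u"
  "vee u (- v) = - vee u v" "vee u 0 = 0"
  by (simp_all add: vee_def tensor_def vec_eq_iff algebra_simps)

lemma nat_cone_coefficients:
  assumes "finite B" "v \<in> nat_cone B"
  shows "\<exists>c :: 'a::real_vector \<Rightarrow> nat. v = (\<Sum>b\<in>B. real (c b) *\<^sub>R b)"
  using assms(2)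
proof (induction rule: nat_cone.induct)
  case zero
  show ?case by (rule exI[of _ "\<lambda>_. 0"]) simp
next
  case (add_gen v b)
  then obtain c where "v = (\<Sum>b\<in>B. real (c b) *\<^sub>R b)" by blast
  moreover have "b = (\<Sum>d\<in>B. (if d = b then b else 0))" using assms(1) add_gen by simp
  ultimately have "v + b = (\<Sum>d\<in>B. real (c d) *\<^sub>R d + (if d = b then b else 0))"
    by (simp only: sum.distrib)
  also have "\<dots> = (\<Sum>d\<in>B. real ((c(b := c b + 1)) d) *\<^sub>R d)"
    by (intro sum.cong) (auto simp: algebra_simps)
  finally show ?case by (rule exI[of _ "c(b := c b + 1)"])
qed

lemma basis_lattice_add: "p \<in> basis_lattice E \<Longrightarrow> q \<in> basis_lattice E \<Longrightarrow> p + q \<in> basis_lattice E"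
  unfolding basis_lattice_def
  by (auto simp: sum.distrib[symmetric] scaleR_add_left[symmetric] of_int_add[symmetric] simp del: of_int_add)

lemma basis_lattice_uminus: "p \<in> basis_lattice E \<Longrightarrow> - p \<in> basis_lattice E"
  unfolding basis_lattice_def
proof clarify
  fix c :: "real ^ 'a ^ 'a \<Rightarrow> int"
  have "- (\<Sum>b\<in>canonical_basis E. real_of_int (c b) *\<^sub>R b) =
      (\<Sum>b\<in>canonical_basis E. real_of_int ((\<lambda>b. - c b) b) *\<^sub>R b)"
    by (simp add: sum_negf)
  then show "\<exists>d. - (\<Sum>b\<in>canonical_basis E. real_of_int (c b) *\<^sub>R b) =
      (\<Sum>b\<in>canonical_basis E. real_of_int (d b) *\<^sub>R b) \<and> True"
    by (intro exI[of _ "\<lambda>b. - c b"] conjI TrueI)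
qed

lemma finite_canonical_basis: "finite (canonical_basis E)"
proof -
  let ?B = "range simple_root \<union> range (\<lambda>(h, i, j). simple_root h + simple_root i + simple_root j) \<union>
    range (highest_root_D E)"
  have "\<beta> \<in> ?B" if "elementary E i \<beta>" for i \<beta>
    using that
  proof cases
    case (path h j)
    then show ?thesis by (auto intro!: range_eqI[of _ _ "(h, i, j)"])
  qed simp_all
  then have "canonical_basis E \<subseteq> (\<Union>i. vee (simple_root i) ` ?B)"
    unfolding canonical_basis_def by (intro subsetI) (elim CollectE exE conjE, intro UN_I[OF UNIV_I] image_eqI)
  then show ?thesis by (rule finite_subset) simp
qed

lemma nat_cone_subset_lattice:
  fixes v :: "real ^ 'n::finite ^ 'n"
  assumes "v \<in> nat_cone (canonical_basis E)"
  shows "v \<in> basis_lattice E"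
proof -
  obtain c where "v = (\<Sum>b\<in>canonical_basis E. real (c b) *\<^sub>R b)"
    using nat_cone_coefficients[OF finite_canonical_basis assms] by blast
  then show ?thesis
    unfolding basis_lattice_def by (intro CollectI exI[of _ "\<lambda>b. int (c b)"]) simp
qed

lemma le2_refl: "q \<in> basis_lattice E \<Longrightarrow> le2 E q q"
  unfolding le2_def by (auto intro!: exI[of _ "\<lambda>_. 0"])

lemma le2_trans: "le2 E p q \<Longrightarrow> le2 E q r \<Longrightarrow> le2 E p r"
  unfolding le2_def
proof (elim conjE exE, intro conjI)
  fix c d assume c: "\<forall>b\<in>canonical_basis E. 0 \<le> c b" "q - p = (\<Sum>b\<in>canonical_basis E. c b *\<^sub>R b)"
    and d: "\<forall>b\<in>canonical_basis E. 0 \<le> d b" "r - q = (\<Sum>b\<in>canonical_basis E. d b *\<^sub>R b)"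
  have "r - p = (q - p) + (r - q)" by simp
  also have "\<dots> = (\<Sum>b\<in>canonical_basis E. (c b + d b) *\<^sub>R b)"
    unfolding c(2) d(2) by (simp add: sum.distrib scaleR_add_left)
  finally show "\<exists>c. (\<forall>b\<in>canonical_basis E. 0 \<le> c b) \<and> r - p = (\<Sum>b\<in>canonical_basis E. c b *\<^sub>R b)"
    using c(1) d(1) by (intro exI[of _ "\<lambda>b. c b + d b"]) auto
qed

lemma le2_of_nat_cone:
  fixes p q :: "real ^ 'n::finite ^ 'n"
  assumes "p \<in> basis_lattice E" "q - p \<in> nat_cone (canonical_basis E)"
  shows "le2 E p q"
proof -
  have "q \<in> basis_lattice E"
    using basis_lattice_add[OF assms(1) nat_cone_subset_lattice[OF assms(2)]] by simp
  moreover obtain c :: "real ^ 'n ^ 'n \<Rightarrow> nat" where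
    "q - p = (\<Sum>b\<in>canonical_basis E. real (c b) *\<^sub>R b)"
    using nat_cone_coefficients[OF finite_canonical_basis assms(2)] by blast
  ultimately show ?thesis
    using assms(1) unfolding le2_def by (auto intro: exI[of _ "\<lambda>b. real (c b)"])
qed

context star_diagram
begin

lemma vee_orthogonal_in_cone:
  assumes "pos_norm2 \<gamma>" "bform E (simple_root i) \<gamma> = 0"
  shows "vee (simple_root i) \<gamma> \<in> nat_cone (canonical_basis E)"
  using orthogonal_in_elementary_cone[OF assms]
proof (induction rule: nat_cone.induct)
  case zero
  then show ?case by (simp add: vee_linear nat_cone.zero)
next
  case (add_gen v b)
  then show ?case unfolding vee_linear
    by (intro nat_cone.add_gen) (auto simp: canonical_basis_def)
qed

lemma vee_orthogonal_in_lattice: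
  assumes "norm2 \<gamma>" "bform E (simple_root i) \<gamma> = 0"
  shows "vee (simple_root i) \<gamma> \<in> basis_lattice E"
  using norm2_pos_or_neg[OF assms(1)]
proof
  assume "pos_norm2 (- \<gamma>)"
  then have "- vee (simple_root i) \<gamma> \<in> basis_lattice E"
    using vee_orthogonal_in_cone[of "- \<gamma>" i] assms(2)
    by (auto simp: vee_linear bform_linear intro: nat_cone_subset_lattice)
  then show ?thesis using basis_lattice_uminus by fastforce
qed (use assms(2) vee_orthogonal_in_cone nat_cone_subset_lattice in blast)

text \<open>
  Induction on the height of \<open>\<alpha>\<close>. Since \<open>B(\<alpha>, \<alpha>) > 0\<close>, some simple reflection lowers the height; it
changes \<open>\<alpha> \<or> \<beta>\<close> by \<open>\<alpha>\<^sub>i \<or> \<gamma>\<close> with an integral \<open>\<gamma>\<close> of norm 2 orthogonal to \<open>\<alpha>\<^sub>i\<close>. Allowing \<open>\<beta>\<close> to be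
negative saves a discussion of the sign of its image.
\<close>

lemma two_root_in_lattice:
  assumes "pos_norm2 \<alpha>" "norm2 \<beta>" "bform E \<alpha> \<beta> = 0"
  shows "vee \<alpha> \<beta> \<in> basis_lattice E"
proof -
  obtain n where "height \<alpha> \<le> real n" using real_arch_simple by blast
  then show ?thesis
    using assms
  proof (induction n arbitrary: \<alpha> \<beta>)
    case 0
    then show ?case using height_pos[of \<alpha>] by simp
  next
    case (Suc n)
    have \<alpha>: "integral_vec \<alpha>" "bform E \<alpha> \<alpha> = 2" "\<And>k. 0 \<le> \<alpha> $ k"
      and \<beta>: "integral_vec \<beta>" "bform E \<beta> \<beta> = 2"
      using Suc.prems by (auto simp: pos_norm2_def norm2_def)
    have "\<exists>i. 0 < \<alpha> $ i * bform E (simple_root i) \<alpha>"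
    proof (rule ccontr)
      assume "\<not> ?thesis"
      then have "bform E \<alpha> \<alpha> \<le> 0"
        unfolding bform_expand[of \<alpha> \<alpha>] by (intro sum_nonpos) (simp add: not_less)
      then show False using \<alpha>(2) by simp
    qed
    then obtain i where "0 < \<alpha> $ i * bform E (simple_root i) \<alpha>" by blast
    then have i: "0 < \<alpha> $ i" "0 < bform E (simple_root i) \<alpha>"
      using \<alpha>(3)[of i] by (auto simp: zero_less_mult_iff)
    let ?a = "simple_root i :: real ^ 'n"
    have aa: "bform E ?a ?a = 2" by (simp add: bform_simple_simple cartan_def)
    show ?case
    proof (cases "\<alpha> = ?a")
      case True
      then show ?thesis using Suc.prems vee_orthogonal_in_lattice[of \<beta> i] by simp
    next
      case False
      have "bform E ?a \<alpha> \<le> 1"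
        using \<alpha> False aa by (intro bform_le_1) (auto simp: integral_vec_simple)
      moreover have "1 \<le> bform E ?a \<alpha>"
        using i(2) \<alpha>(1) by (intro Ints_pos_ge_1 bform_integral) (auto simp: integral_vec_simple)
      ultimately have x: "bform E ?a \<alpha> = 1" by simp
      define y where "y = bform E ?a \<beta>"
      have yZ: "y \<in> \<int>" using \<beta> by (simp add: y_def bform_integral integral_vec_simple)
      note sy = bform_sym[of \<alpha> ?a] bform_sym[of \<beta> ?a] bform_sym[of \<beta> \<alpha>]
      \<comment> \<open>\<open>?\<alpha>'\<close> and \<open>?\<beta>'\<close> are the images under the reflection in \<open>\<alpha>\<^sub>i\<close>.\<close>
      let ?\<alpha>' = "\<alpha> - ?a" and ?\<beta>' = "\<beta> - y *\<^sub>R ?a"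
      let ?\<gamma> = "y *\<^sub>R \<alpha> + \<beta> - y *\<^sub>R ?a"
      have "pos_norm2 ?\<alpha>'"
      proof -
        have "0 \<le> ?\<alpha>' $ k" for k
          using \<alpha>(3)[of k] pos_norm2_ge_1[OF Suc.prems(2) i(1)] by (auto simp: simple_root_nth)
        then show ?thesis using \<alpha> aa x sy
          by (auto simp: pos_norm2_def norm2_def bform_linear intro: integral_vec_intros)
      qed
      moreover have "norm2 ?\<beta>'" using \<beta> aa yZ sy y_def
        by (auto simp: norm2_def bform_linear algebra_simps intro!: integral_vec_intros)
      moreover have "bform E ?\<alpha>' ?\<beta>' = 0"
        using Suc.prems aa x sy y_def by (simp add: bform_linear)
      moreover have "height ?\<alpha>' \<le> real n" using Suc.prems(1) by (simp add: height_linear)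
      ultimately have 1: "vee ?\<alpha>' ?\<beta>' \<in> basis_lattice E" by (intro Suc.IH)
      have "norm2 ?\<gamma>" using \<alpha> \<beta> aa yZ sy y_def x Suc.prems(4)
        by (auto simp: norm2_def bform_linear algebra_simps intro!: integral_vec_intros)
      moreover have "bform E ?a ?\<gamma> = 0" using x y_def aa by (simp add: bform_linear)
      ultimately have 2: "vee ?a ?\<gamma> \<in> basis_lattice E" by (rule vee_orthogonal_in_lattice)
      have "vee \<alpha> \<beta> = vee ?\<alpha>' ?\<beta>' + vee ?a ?\<gamma>"
        by (simp add: vee_linear vee_sym[of \<alpha> ?a] algebra_simps)
      then show ?thesis using basis_lattice_add[OF 1 2] by simp
    qed
  qed
qed

end

section \<open>Roots and orbits of pairs\<close>

context posdef_diagram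
begin

lemma bform_simple_refl: "bform E (simple_refl E i u) (simple_refl E i v) = bform E u v"
  by (simp add: simple_refl_def bform_linear bform_sym[of u "simple_root i"] bform_simple_simple cartan_def)

lemma weyl_group_props:
  assumes "w \<in> weyl_group E"
  shows "bform E (w u) (w v) = bform E u v" "w (- u) = - w u" "integral_vec u \<Longrightarrow> integral_vec (w u)"
  using assms
  by (induction arbitrary: u v)
    (auto simp: bform_simple_refl, auto simp: simple_refl_def bform_linear
      intro!: integral_vec_intros bform_integral)

lemma weyl_group_comp: "u \<in> weyl_group E \<Longrightarrow> w \<in> weyl_group E \<Longrightarrow> u \<circ> w \<in> weyl_group E"
  by (induction rule: weyl_group.induct) (auto simp: comp_assoc intro: weyl_group.step)

lemma simple_refl_in_weyl_group: "simple_refl E i \<in> weyl_group E"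
  using weyl_group.step[OF weyl_group.one] by simp

lemma roots_weyl: "w \<in> weyl_group E \<Longrightarrow> \<alpha> \<in> roots E \<Longrightarrow> w \<alpha> \<in> roots E"
  unfolding roots_def using weyl_group_comp[of w] by (force simp: comp_def)

lemma simple_refl_simple: "simple_refl E i (simple_root i) = - simple_root i"
  by (simp add: simple_refl_def bform_simple_simple cartan_def scaleR_2)

lemma roots_uminus: "\<alpha> \<in> roots E \<Longrightarrow> - \<alpha> \<in> roots E"
proof -
  assume "\<alpha> \<in> roots E"
  then obtain w i where w: "w \<in> weyl_group E" "\<alpha> = w (simple_root i)" by (auto simp: roots_def)
  have "- \<alpha> = (w \<circ> simple_refl E i) (simple_root i)"
    using weyl_group_props(2)[OF w(1)] w(2) by (simp add: simple_refl_simple)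
  then show ?thesis using weyl_group_comp[OF w(1) simple_refl_in_weyl_group] unfolding roots_def by blast
qed

lemma roots_norm2: "\<alpha> \<in> roots E \<Longrightarrow> norm2 \<alpha>"
  using norm2_simple weyl_group_props(1,3) unfolding roots_def norm2_def by force

lemma pos_roots_iff: "\<alpha> \<in> pos_roots E \<longleftrightarrow> \<alpha> \<in> roots E \<and> pos_norm2 \<alpha>"
  using roots_norm2 by (auto simp: pos_roots_def pos_norm2_def)

lemma simple_root_pos_root: "simple_root i \<in> pos_roots E"
  using pos_norm2_simple unfolding pos_roots_iff roots_def
  by (auto intro!: exI[of _ id] weyl_group.one)

lemma roots_pos_or_neg: "\<alpha> \<in> roots E \<Longrightarrow> \<alpha> \<in> pos_roots E \<or> - \<alpha> \<in> pos_roots E"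
  using norm2_pos_or_neg roots_norm2 roots_uminus by (auto simp: pos_roots_iff)

lemma pos_roots_not_neg: "\<alpha> \<in> pos_roots E \<Longrightarrow> - \<alpha> \<notin> pos_roots E"
  using height_pos[of \<alpha>] height_pos[of "- \<alpha>"] by (auto simp: pos_roots_iff height_linear)

text \<open>
  Reflection in \<open>\<alpha>\<^sub>i\<close> changes only the coefficient at \<open>i\<close>, and a positive root other than \<open>\<alpha>\<^sub>i\<close> has
another positive coefficient, which decides the sign of the image.
\<close>

lemma simple_refl_pos_root:
  assumes "\<alpha> \<in> pos_roots E" "\<alpha> \<noteq> simple_root i"
  shows "simple_refl E i \<alpha> \<in> pos_roots E"
proof (rule ccontr)
  assume "\<not> ?thesis"
  moreover have "simple_refl E i \<alpha> \<in> roots E"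
    using assms(1) roots_weyl simple_refl_in_weyl_group by (simp add: pos_roots_iff)
  ultimately have "- simple_refl E i \<alpha> \<in> pos_roots E" using roots_pos_or_neg by blast
  then have neg: "simple_refl E i \<alpha> $ k \<le> 0" for k by (simp add: pos_roots_def)
  have nn: "0 \<le> \<alpha> $ k" for k using assms(1) by (simp add: pos_roots_def)
  have "\<alpha> $ k = 0" if "k \<noteq> i" for k
    using neg[of k] nn[of k] that by (simp add: simple_refl_def simple_root_nth)
  then have eq: "\<alpha> = \<alpha> $ i *\<^sub>R simple_root i" by (auto simp: vec_eq_iff simple_root_nth)
  have "bform E \<alpha> \<alpha> = 2" using assms(1) by (simp add: pos_roots_iff pos_norm2_def norm2_def)
  then have "\<alpha> $ i * \<alpha> $ i = 1"
    by (subst (asm) (1 2) eq) (simp add: bform_linear bform_simple_simple cartan_def)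
  then have "\<alpha> $ i = 1" using nn[of i] by (simp add: square_eq_1_iff)
  then show False using eq assms(2) by simp
qed

lemma orth_pairs_doubleton:
  "{\<alpha>, \<beta>} \<in> orth_pairs E \<longleftrightarrow> \<alpha> \<in> pos_roots E \<and> \<beta> \<in> pos_roots E \<and> bform E \<alpha> \<beta> = 0"
  unfolding orth_pairs_def by (auto simp: doubleton_eq_iff bform_sym)

lemma pair_act_doubleton:
  assumes "u \<in> pos_roots E" "v \<in> pos_roots E" "u = w \<alpha> \<or> u = - w \<alpha>" "v = w \<beta> \<or> v = - w \<beta>"
  shows "pair_act E w {\<alpha>, \<beta>} = {u, v}"
  using assms pos_roots_not_neg[OF assms(1)] pos_roots_not_neg[OF assms(2)]
  unfolding pair_act_def by auto

lemma pair_act_orth_pairs: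
  assumes "\<rho> \<in> orth_pairs E" "w \<in> weyl_group E"
  shows "pair_act E w \<rho> \<in> orth_pairs E"
proof -
  obtain \<alpha> \<beta> where \<rho>: "\<rho> = {\<alpha>, \<beta>}" "\<alpha> \<in> pos_roots E" "\<beta> \<in> pos_roots E" "bform E \<alpha> \<beta> = 0"
    using assms(1) by (auto simp: orth_pairs_def)
  obtain u v where uv: "u \<in> pos_roots E" "v \<in> pos_roots E" "u = w \<alpha> \<or> u = - w \<alpha>" "v = w \<beta> \<or> v = - w \<beta>"
    using \<rho>(2,3) roots_weyl[OF assms(2)] roots_pos_or_neg pos_roots_iff by metis
  have "bform E u v = 0"
    using uv(3,4) weyl_group_props(1)[OF assms(2), of \<alpha> \<beta>] \<rho>(4) by (auto simp: bform_linear)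
  then show ?thesis using pair_act_doubleton[of u v w \<alpha> \<beta>] uv \<rho>(1) by (simp add: orth_pairs_doubleton)
qed

lemma pair_orbit_orth: "pair_orbit E X \<Longrightarrow> \<rho> \<in> X \<Longrightarrow> \<rho> \<in> orth_pairs E"
  using pair_act_orth_pairs by (auto simp: pair_orbit_def)

text \<open>
  If \<open>\<alpha>\<^sub>i\<close> belongs to the pair, the reflection negates it and fixes the other root, which is orthogonal
to it; so the pair does not move.
\<close>

lemma moved_pair:
  assumes "{\<alpha>, \<beta>} \<in> orth_pairs E" "pair_act E (simple_refl E i) {\<alpha>, \<beta>} \<noteq> {\<alpha>, \<beta>}"
  shows "pair_act E (simple_refl E i) {\<alpha>, \<beta>} = {simple_refl E i \<alpha>, simple_refl E i \<beta>}"
proof -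
  have p: "\<alpha> \<in> pos_roots E" "\<beta> \<in> pos_roots E" "bform E \<alpha> \<beta> = 0" "bform E \<beta> \<alpha> = 0"
    using assms(1) by (auto simp: orth_pairs_doubleton bform_sym)
  have "\<alpha> \<noteq> simple_root i"
  proof
    assume "\<alpha> = simple_root i"
    then show False
      using assms(2) p pair_act_doubleton[of \<alpha> \<beta> "simple_refl E i" \<alpha> \<beta>] simple_refl_simple[of i]
      by (simp add: simple_refl_def)
  qed
  moreover have "\<beta> \<noteq> simple_root i"
  proof
    assume "\<beta> = simple_root i"
    then show False
      using assms(2) p pair_act_doubleton[of \<alpha> \<beta> "simple_refl E i" \<alpha> \<beta>] simple_refl_simple[of i]
      by (simp add: simple_refl_def)
  qed
  ultimately show ?thesis using p by (intro pair_act_doubleton simple_refl_pos_root) auto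
qed

lemma simple_coefficient_range:
  assumes "\<alpha> \<in> pos_roots E" "simple_refl E i \<alpha> \<in> pos_roots E"
  shows "bform E (simple_root i) \<alpha> \<in> {-1, 0, 1}"
proof -
  note not_neg = pos_roots_not_neg[OF simple_root_pos_root[of i]]
  have \<alpha>: "integral_vec \<alpha>" "bform E \<alpha> \<alpha> = 2"
    using assms(1) by (auto simp: pos_roots_iff pos_norm2_def norm2_def)
  have ne: "\<alpha> \<noteq> - simple_root i" "\<alpha> \<noteq> simple_root i"
    using assms not_neg simple_refl_simple by auto
  have aa: "bform E (simple_root i) (simple_root i) = 2" by (simp add: bform_simple_simple cartan_def)
  have "bform E (simple_root i) \<alpha> \<le> 1"
    using \<alpha> ne aa by (intro bform_le_1) (auto simp: integral_vec_simple)
  moreover have "bform E (- simple_root i) \<alpha> \<le> 1"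
    using \<alpha> ne aa by (intro bform_le_1) (auto simp: integral_vec_simple integral_vec_uminus bform_linear)
  moreover have "bform E (simple_root i) \<alpha> \<in> \<int>" using \<alpha>(1) by (intro bform_integral integral_vec_simple)
  ultimately show ?thesis by (auto simp: bform_linear elim!: Ints_cases)
qed

section \<open>Covers of the monoidal order\<close>

text \<open>
  Expanding the symmetric product gives the third claim, and \<open>\<gamma>\<close> has norm 2 and is orthogonal to
\<open>\<alpha>\<^sub>i\<close> by computation. So \<open>\<gamma>\<close> or \<open>-\<gamma>\<close> is positive, and the sign is the sign of its height, which the
comparison of minimal heights decides.
\<close>

lemma cover_difference:
  fixes \<alpha> \<beta> i
  defines "x \<equiv> bform E (simple_root i) \<alpha>" and "y \<equiv> bform E (simple_root i) \<beta>"
  defines "\<gamma> \<equiv> (x * y) *\<^sub>R simple_root i - y *\<^sub>R \<alpha> - x *\<^sub>R \<beta>"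
  assumes p: "pos_norm2 \<alpha>" "pos_norm2 \<beta>" "bform E \<alpha> \<beta> = 0"
    and x: "x \<in> {-1, 0, 1}" and y: "y \<in> {-1, 0, 1}" and xy: "\<not> (x = 0 \<and> y = 0)"
    and less: "pair_less {\<alpha>, \<beta>} {simple_refl E i \<alpha>, simple_refl E i \<beta>}"
  shows "pos_norm2 \<gamma>" "bform E (simple_root i) \<gamma> = 0"
    "vee (simple_refl E i \<alpha>) (simple_refl E i \<beta>) - vee \<alpha> \<beta> = vee (simple_root i) \<gamma>"
proof -
  let ?a = "simple_root i :: real ^ 'n"
  have aa: "bform E ?a ?a = 2" by (simp add: bform_simple_simple cartan_def)
  note sy = bform_sym[of \<alpha> ?a] bform_sym[of \<beta> ?a] bform_sym[of \<beta> \<alpha>]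
  have n: "integral_vec \<alpha>" "bform E \<alpha> \<alpha> = 2" "integral_vec \<beta>" "bform E \<beta> \<beta> = 2"
    using p by (auto simp: pos_norm2_def norm2_def)
  show "bform E (simple_root i) \<gamma> = 0"
    unfolding \<gamma>_def using aa by (simp add: bform_linear x_def[symmetric] y_def[symmetric])
  show "vee (simple_refl E i \<alpha>) (simple_refl E i \<beta>) - vee \<alpha> \<beta> = vee (simple_root i) \<gamma>"
    unfolding \<gamma>_def simple_refl_def x_def[symmetric] y_def[symmetric]
    by (simp add: vee_linear vee_sym[of \<alpha> ?a] algebra_simps)
  have "bform E \<gamma> \<gamma> = 2 * x\<^sup>2 + 2 * y\<^sup>2 - 2 * (x * y)\<^sup>2"
    unfolding \<gamma>_def using aa n sy p(3)
    by (simp add: bform_linear x_def[symmetric] y_def[symmetric] power2_eq_square algebra_simps)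
  also have "\<dots> = 2" using x y xy by auto
  finally have norm: "norm2 \<gamma>"
    using n x y unfolding norm2_def \<gamma>_def by (auto intro!: integral_vec_intros)
  show "pos_norm2 \<gamma>"
  proof (rule ccontr)
    assume "\<not> ?thesis"
    then have "0 < height (- \<gamma>)" using norm2_pos_or_neg[OF norm] height_pos by blast
    then have h: "x * y < y * height \<alpha> + x * height \<beta>" by (simp add: \<gamma>_def height_linear)
    define u v where "u = simple_refl E i \<alpha>" and "v = simple_refl E i \<beta>"
    have uv: "u = \<alpha> - x *\<^sub>R ?a" "v = \<beta> - y *\<^sub>R ?a" by (simp_all add: u_def v_def simple_refl_def x_def y_def)
    have hu: "height u = height \<alpha> - x" "height v = height \<beta> - y" by (simp_all add: uv height_linear)
    have un: "bform E \<alpha> v = - (x * y)" "bform E \<beta> u = - (x * y)"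
      using p(3) sy by (simp_all add: uv bform_linear x_def y_def)
    obtain \<gamma>1 \<gamma>2 where g: "\<gamma>1 \<in> {\<alpha>, \<beta>} - {u, v}" "\<gamma>2 \<in> {u, v} - {\<alpha>, \<beta>}" "height \<gamma>1 < height \<gamma>2"
      "\<And>z. z \<in> {\<alpha>, \<beta>} - {u, v} \<Longrightarrow> height \<gamma>1 \<le> height z"
      "\<And>z. z \<in> {u, v} - {\<alpha>, \<beta>} \<Longrightarrow> height \<gamma>2 \<le> height z"
      using less unfolding pair_less_def is_arg_min_def u_def v_def by (auto simp: not_less) 
    consider "x = 0" | "y = 0" | "x \<noteq> 0" "y \<noteq> 0" by blast
    then show False
    proof cases
      case 1
      then have "u = \<alpha>" by (simp add: uv)
      then have "\<gamma>1 = \<beta>" "\<gamma>2 = v" using g(1,2) by auto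
      then have "y < 0" using g(3) hu by simp
      then have "y * height \<alpha> < 0" using height_pos[OF p(1)] by (simp add: mult_neg_pos)
      then show False using h 1 by simp
    next
      case 2
      then have "v = \<beta>" by (simp add: uv)
      then have "\<gamma>1 = \<alpha>" "\<gamma>2 = u" using g(1,2) by auto
      then have "x < 0" using g(3) hu by simp
      then have "x * height \<beta> < 0" using height_pos[OF p(2)] by (simp add: mult_neg_pos)
      then show False using h 2 by simp
    next
      case 3
      then have "x * y = 1 \<or> x * y = -1" using x y by auto
      \<comment> \<open>Both roots move, and the old and the new pair are disjoint because the mixed products differ from 2.\<close>
      then have "\<alpha> \<noteq> v" "\<beta> \<noteq> u" using un n(2,4) by auto
      moreover have "\<alpha> \<noteq> u" "\<beta> \<noteq> v" using 3 hu by auto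
      ultimately have "{\<alpha>, \<beta>} - {u, v} = {\<alpha>, \<beta>}" "{u, v} - {\<alpha>, \<beta>} = {u, v}" by auto
      then have "height \<gamma>1 = height \<alpha> \<or> height \<gamma>1 = height \<beta>" "height \<gamma>2 \<le> height u" "height \<gamma>2 \<le> height v"
        using g by auto
      then show False using g(3) h hu 3 x y height_pos[OF p(1)] height_pos[OF p(2)] by auto
    qed
  qed
qed

end

theorem proposition6p4:
  fixes E :: "'n::finite \<Rightarrow> 'n \<Rightarrow> bool"
    and X :: "(real ^ 'n) set set"
  assumes "ade_diagram E"
    and "pair_orbit E X"
  shows "(\<forall>\<alpha> \<beta> \<rho>2. {\<alpha>, \<beta>} \<in> X \<and> monoidal_cover E X {\<alpha>, \<beta>} \<rho>2 \<longrightarrow>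
            (\<exists>i. \<rho>2 = {simple_refl E i \<alpha>, simple_refl E i \<beta>}) \<and>
            (\<forall>i x y. \<rho>2 = {simple_refl E i \<alpha>, simple_refl E i \<beta>} \<and>
                x = bform E (simple_root i) \<alpha> \<and> y = bform E (simple_root i) \<beta> \<longrightarrow>
                x \<in> {-1, 0, 1} \<and> y \<in> {-1, 0, 1} \<and> \<not> (x = 0 \<and> y = 0))) \<and>
         (\<forall>\<rho>1\<in>X. \<forall>\<rho>2\<in>X. monoidal_le E X \<rho>1 \<rho>2 \<longrightarrow> pair_le2 E \<rho>1 \<rho>2)"
proof -
  obtain d :: "'n \<Rightarrow> real" where d: "\<forall>i. 0 < d i \<and> \<not> E i i \<and> (\<Sum>j | E i j. d j) < 2 * d i"
    and sym: "\<forall>i j. E i j \<longrightarrow> E j i" and deg: "\<forall>i. card {j. E i j} \<le> 3"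
    and br: "\<forall>i j. branch_vertex E i \<longrightarrow> branch_vertex E j \<longrightarrow> i = j"
    using ade_diagram_weights[OF assms(1)] by blast
  interpret star_diagram E
    using d sym deg br posdef_of_weights[of E d] by unfold_locales blast+
  note orth = pair_orbit_orth[OF assms(2)]
  have cover: "\<exists>i. \<rho>2 = {simple_refl E i \<alpha>, simple_refl E i \<beta>}"
    if "monoidal_cover E X {\<alpha>, \<beta>} \<rho>2" for \<alpha> \<beta> \<rho>2
    using that moved_pair orth unfolding monoidal_cover_def by (metis Diff_iff singletonI)
  have range: "bform E (simple_root i) \<alpha> \<in> {-1, 0, 1} \<and> bform E (simple_root i) \<beta> \<in> {-1, 0, 1} \<and>
      \<not> (bform E (simple_root i) \<alpha> = 0 \<and> bform E (simple_root i) \<beta> = 0)"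
    if c: "monoidal_cover E X {\<alpha>, \<beta>} \<rho>2" and \<rho>2: "\<rho>2 = {simple_refl E i \<alpha>, simple_refl E i \<beta>}" for \<alpha> \<beta> \<rho>2 i
  proof -
    have "{\<alpha>, \<beta>} \<in> orth_pairs E" "{simple_refl E i \<alpha>, simple_refl E i \<beta>} \<in> orth_pairs E"
      and ne: "{simple_refl E i \<alpha>, simple_refl E i \<beta>} \<noteq> {\<alpha>, \<beta>}"
      using c orth unfolding monoidal_cover_def \<rho>2 by auto
    then have "bform E (simple_root i) \<alpha> \<in> {-1, 0, 1}" "bform E (simple_root i) \<beta> \<in> {-1, 0, 1}"
      using simple_coefficient_range by (auto simp only: orth_pairs_doubleton)
    then show ?thesis using ne by (auto simp: simple_refl_def)
  qed
  have refines: "\<exists>\<alpha> \<beta> \<alpha>' \<beta>'. \<rho>1 = {\<alpha>, \<beta>} \<and> \<rho>2 = {\<alpha>', \<beta>'} \<and> le2 E (vee \<alpha> \<beta>) (vee \<alpha>' \<beta>')"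
    if "(monoidal_cover E X)\<^sup>*\<^sup>* \<rho>1 \<rho>2" "\<rho>1 \<in> X" for \<rho>1 \<rho>2
    using that
  proof (induction rule: rtranclp_induct)
    case base
    then obtain \<alpha> \<beta> where "\<rho>1 = {\<alpha>, \<beta>}" "\<alpha> \<in> pos_roots E" "\<beta> \<in> pos_roots E" "bform E \<alpha> \<beta> = 0"
      using orth[of \<rho>1] by (auto simp: orth_pairs_def)
    then show ?case using le2_refl[OF two_root_in_lattice, of \<alpha> \<beta>] by (auto simp: pos_roots_iff pos_norm2_def)
  next
    case (step \<rho> \<rho>')
    then obtain \<alpha>1 \<beta>1 \<alpha> \<beta> where ih: "\<rho>1 = {\<alpha>1, \<beta>1}" "\<rho> = {\<alpha>, \<beta>}" "le2 E (vee \<alpha>1 \<beta>1) (vee \<alpha> \<beta>)"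
      by blast
    obtain i where \<rho>': "\<rho>' = {simple_refl E i \<alpha>, simple_refl E i \<beta>}"
      using cover step.hyps(2) ih(2) by blast
    have p: "pos_norm2 \<alpha>" "pos_norm2 \<beta>" "bform E \<alpha> \<beta> = 0"
      using orth[of \<rho>] step.hyps(2) ih(2)
      by (auto simp: monoidal_cover_def orth_pairs_doubleton pos_roots_iff)
    have r: "bform E (simple_root i) \<alpha> \<in> {-1, 0, 1}" "bform E (simple_root i) \<beta> \<in> {-1, 0, 1}"
      "\<not> (bform E (simple_root i) \<alpha> = 0 \<and> bform E (simple_root i) \<beta> = 0)"
      using range[of \<alpha> \<beta> \<rho>' i] step.hyps(2) ih(2) \<rho>' by blast+
    have less: "pair_less {\<alpha>, \<beta>} {simple_refl E i \<alpha>, simple_refl E i \<beta>}"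
      using step.hyps(2) unfolding monoidal_cover_def ih(2) \<rho>' by blast
    note \<gamma> = cover_difference[OF p r less]
    have "le2 E (vee \<alpha> \<beta>) (vee (simple_refl E i \<alpha>) (simple_refl E i \<beta>))"
      using two_root_in_lattice[OF p(1) _ p(3)] p(2) vee_orthogonal_in_cone[OF \<gamma>(1,2)]
      by (intro le2_of_nat_cone) (auto simp: \<gamma>(3) pos_norm2_def)
    then show ?case using le2_trans[OF ih(3)] ih(1) \<rho>' by blast
  qed
  show ?thesis
  proof (intro conjI allI impI ballI)
    fix \<alpha> \<beta> \<rho>2 assume c: "{\<alpha>, \<beta>} \<in> X \<and> monoidal_cover E X {\<alpha>, \<beta>} \<rho>2"
    show "\<exists>i. \<rho>2 = {simple_refl E i \<alpha>, simple_refl E i \<beta>}" using cover c by blast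
    fix i x y assume "\<rho>2 = {simple_refl E i \<alpha>, simple_refl E i \<beta>} \<and>
      x = bform E (simple_root i) \<alpha> \<and> y = bform E (simple_root i) \<beta>"
    then show "x \<in> {-1, 0, 1}" "y \<in> {-1, 0, 1}" "\<not> (x = 0 \<and> y = 0)"
      using range[of \<alpha> \<beta> \<rho>2 i] c by simp_all
  next
    fix \<rho>1 \<rho>2 assume "\<rho>1 \<in> X" "\<rho>2 \<in> X" "monoidal_le E X \<rho>1 \<rho>2"
    then show "pair_le2 E \<rho>1 \<rho>2"
      using refines[of \<rho>1 \<rho>2] orth[of \<rho>1] orth[of \<rho>2]
      unfolding monoidal_le_def pair_le2_def by blast
  qed
qed

end
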